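(* Let $\mathcal{L}^+$ be the class of cofibrations and $\mathcal{R}^+$ the class of fibrations in the category $\mathbf{1\text{-}Cob^+}$, that is, the classes of morphisms of $\mathbf{1\text{-}Cob^+}$ whose images under the functor $\Phi:\mathbf{1\text{-}Cob^+}\to\mathbf{2\text{-}Cob}$ are cofibrations, respectively fibrations, in $\mathbf{2\text{-}Cob}$. Then $(\mathcal{L}^+,\mathcal{R}^+)$ is an orthogonal factorization system on $\mathbf{1\text{-}Cob^+}$.
   Context: Convention: $\mathbb{N}=\{0,1,2,\dots\}$. The category $\mathbf{1\text{-}Cob^+}$. Objects are finite signed sets $m=m_-\sqcup m_+$. A cobordism $\theta:m\to n$ is a finite set $C$ with functions $l_m:m\to C$, $l_n:n\to C$ such that each $c\in C$ satisfies one of: (i) $l_m^{-1}(c)=\{a,b\}$ with $a\in m_+$, $b\in m_-$, and $l_n^{-1}(c)=\emptyset$; (ii) $l_n^{-1}(c)=\{a,b\}$ with $a\in n_+$, $b\in n_-$, and $l_m^{-1}(c)=\emptyset$; (iii) $l_m^{-1}(c)=\{a\}$, $l_n^{-1}(c)=\{b\}$ with $a\in m_+$, $b\in n_+$; (iv) $l_m^{-1}(c)=\{a\}$, $l_n^{-1}(c)=\{b\}$ with $a\in m_-$, $b\in n_-$; (v) $l_m^{-1}(c)=l_n^{-1}(c)=\emptyset$ (a closed loop). Two such cobordisms $m\to n$ are identified when there is a bijection of the sets $C$ compatible with the maps from $m$ and $n$. The composite of $\{m,k,A,l_m,l_k\}$ and $\{k,n,B,l_k',l_n\}$ is $\{m,n,C,\iota_Al_m,\iota_Bl_n\}$,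 where $C$, with maps $\iota_A,\iota_B$, is the pushout of $A\xleftarrow{l_k}k\xrightarrow{l_k'}B$ in sets. The identity of $m$ has $C=m$ and both maps the identity. The category $\mathbf{2\text{-}Cob}$. Objects are finite sets (up to the choice of enumeration $m=\{1,\dots,m\}$). A cobordism $m\to n$ is $\{m,n,C,l_m,l_n,g\}$ with $C$ a finite set, $l_m:m\to C$, $l_n:n\to C$, $g:C\to\mathbb{N}$ functions, identified up to bijections of $C$ compatible with $l_m,l_n,g$. The composite of $\{m,k,A,l_m,l_{k_1},g_1\}$ and $\{k,n,B,l_{k_2},l_n,g_2\}$ is $\{m,n,C,\iota_Al_m,\iota_Bl_n,g\}$ with $C$ the pushout of $A\leftarrow k\to B$ and $g(x)=1+\sum_{\iota_A(a)=x}(g_1(a)-1)+\sum_{\iota_B(b)=x}(g_2(b)-1)+\#\{y\in k: y\mapsto x\}$. The functor $\Phi$ sends a signed set to its underlying set and $\{m,n,C,l_m,l_n\}$ to $\{m,n,C,l_m,l_n,0\}$ (genus identically zero). In $\mathbf{2\text{-}Cob}$, $\{m,n,C,l_m,l_n,g\}$ is a cofibration if $l_n$ is injective and there is $u:n\to m$ with $l_n=l_m\circ u$; it is a fibration if $l_m$ is injective, $l_n$ is surjective, and $g\circ l_m=0$. Equivalently in $\mathbf{1\text{-}Cob^+}$: a cobordism $m\to n$ is a cofibration iff no two points of $n$ are connected to each other (no $c\in C$ of type (ii)); it is a fibration iff no two points of $m$ are connected to each other and there are no closed loops (no $c\in C$ of type (i) or (v)). An orthogonal factorization system on a category consists of two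 classes of morphisms $\mathcal{L},\mathcal{R}$ such that: (1) both are closed under composition and contain all isomorphisms; (2) every morphism $f$ factors as $f=re$ with $e\in\mathcal{L}$, $r\in\mathcal{R}$; (3) for every commutative square $ve=ru$ with $e:X\to Y$ in $\mathcal{L}$, $r:X'\to Y'$ in $\mathcal{R}$, and $u:X\to X'$, $v:Y\to Y'$ arbitrary, there is a unique $w:Y\to X'$ with $we=u$ and $rw=v$. *)

theory Defs
  imports Main
begin

section \<open>Categories and orthogonal factorization systems\<close>

record ('o, 'm) cat =
  Ob :: "'o set"
  Hom :: "'o \<Rightarrow> 'o \<Rightarrow> 'm set"
  Id :: "'o \<Rightarrow> 'm"
  cmp :: "'m \<Rightarrow> 'm \<Rightarrow> 'm" (infixr "\<cdot>\<index>" 70)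

text \<open>The composite \<open>g \<cdot>\<^bsub>C\<^esub> f\<close> is ``\<open>g\<close> after \<open>f\<close>''.\<close>

locale category =
  fixes C :: "('o, 'm) cat" (structure)
  assumes Hom_Ob: "f \<in> Hom C X Y \<Longrightarrow> X \<in> Ob C \<and> Y \<in> Ob C"
    and Hom_disjoint: "\<lbrakk>f \<in> Hom C X Y; f \<in> Hom C X' Y'\<rbrakk> \<Longrightarrow> X = X' \<and> Y = Y'"
    and Id_Hom: "X \<in> Ob C \<Longrightarrow> Id C X \<in> Hom C X X"
    and cmp_Hom: "\<lbrakk>f \<in> Hom C X Y; g \<in> Hom C Y Z\<rbrakk> \<Longrightarrow> g \<cdot> f \<in> Hom C X Z"
    and Id_left: "f \<in> Hom C X Y \<Longrightarrow> Id C Y \<cdot> f = f"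
    and Id_right: "f \<in> Hom C X Y \<Longrightarrow> f \<cdot> Id C X = f"
    and cmp_assoc: "\<lbrakk>f \<in> Hom C W X; g \<in> Hom C X Y; h \<in> Hom C Y Z\<rbrakk>
      \<Longrightarrow> h \<cdot> (g \<cdot> f) = (h \<cdot> g) \<cdot> f"

definition Arr :: "('o, 'm) cat \<Rightarrow> 'm set" where
  "Arr C = (\<Union>X\<in>Ob C. \<Union>Y\<in>Ob C. Hom C X Y)"

definition isomorphisms :: "('o, 'm) cat \<Rightarrow> 'm set" where
  "isomorphisms C = {f. \<exists>X\<in>Ob C. \<exists>Y\<in>Ob C. f \<in> Hom C X Y \<and>
     (\<exists>g\<in>Hom C Y X. g \<cdot>\<^bsub>C\<^esub> f = Id C X \<and> f \<cdot>\<^bsub>C\<^esub> g = Id C Y)}"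

definition closed_under_cmp :: "('o, 'm) cat \<Rightarrow> 'm set \<Rightarrow> bool" where
  "closed_under_cmp C S \<longleftrightarrow> (\<forall>X Y Z. \<forall>f\<in>S \<inter> Hom C X Y. \<forall>g\<in>S \<inter> Hom C Y Z. g \<cdot>\<^bsub>C\<^esub> f \<in> S)"

locale orthogonal_factorization_system = category C
  for C :: "('o, 'm) cat" (structure) and L R :: "'m set" +
  assumes L_Arr: "L \<subseteq> Arr C"
    and R_Arr: "R \<subseteq> Arr C"
    and L_closed: "closed_under_cmp C L"
    and R_closed: "closed_under_cmp C R"
    and L_iso: "isomorphisms C \<subseteq> L"
    and R_iso: "isomorphisms C \<subseteq> R"
    and factorization: "f \<in> Hom C X Y \<Longrightarrow>
      \<exists>Z\<in>Ob C. \<exists>e\<in>L \<inter> Hom C X Z. \<exists>r\<in>R \<inter> Hom C Z Y. f = r \<cdot> e"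
    and lifting: "\<lbrakk>e \<in> L; e \<in> Hom C X Y; r \<in> R; r \<in> Hom C X' Y';
        u \<in> Hom C X X'; v \<in> Hom C Y Y'; v \<cdot> e = r \<cdot> u\<rbrakk>
      \<Longrightarrow> \<exists>!w. w \<in> Hom C Y X' \<and> w \<cdot> e = u \<and> r \<cdot> w = v"


section \<open>Pushouts of sets\<close>

text \<open>For \<open>f : K \<rightarrow> A\<close> and \<open>g : K \<rightarrow> B\<close>, \<open>glue K f g\<close> is the equivalence relation generated by
  \<open>Inl (f y) \<sim> Inr (g y)\<close> for \<open>y \<in> K\<close>. It is the identity outside the images of \<open>f\<close> and \<open>g\<close>, so
  the classes of elements of \<open>A <+> B\<close> are subsets of \<open>A <+> B\<close>.\<close>

definition glue :: "'a set \<Rightarrow> ('a \<Rightarrow> 'c) \<Rightarrow> ('a \<Rightarrow> 'd) \<Rightarrow> ('c + 'd) rel" where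
  "glue K f g = (let S = (\<lambda>y. (Inl (f y), Inr (g y))) ` K in (S \<union> S\<inverse>)\<^sup>*)"

definition pushout ::
    "'c set \<Rightarrow> 'd set \<Rightarrow> 'a set \<Rightarrow> ('a \<Rightarrow> 'c) \<Rightarrow> ('a \<Rightarrow> 'd) \<Rightarrow> ('c + 'd) set set" where
  "pushout A B K f g = (A <+> B) // glue K f g"

definition pushout_inl :: "'a set \<Rightarrow> ('a \<Rightarrow> 'c) \<Rightarrow> ('a \<Rightarrow> 'd) \<Rightarrow> 'c \<Rightarrow> ('c + 'd) set" where
  "pushout_inl K f g a = glue K f g `` {Inl a}"

definition pushout_inr :: "'a set \<Rightarrow> ('a \<Rightarrow> 'c) \<Rightarrow> ('a \<Rightarrow> 'd) \<Rightarrow> 'd \<Rightarrow> ('c + 'd) set" where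
  "pushout_inr K f g b = glue K f g `` {Inr b}"


section \<open>Oriented one-dimensional cobordisms\<close>

datatype 'a signed_set = Signed (neg: "'a set") (pos: "'a set")

definition points :: "'a signed_set \<Rightarrow> 'a set" where
  "points m = neg m \<union> pos m"

definition finite_signed_sets :: "'a signed_set set" where
  "finite_signed_sets = {m. finite (neg m) \<and> finite (pos m) \<and> neg m \<inter> pos m = {}}"

text \<open>The structure maps are total functions of which only the values on the points of the source
  and of the target matter.\<close>

record ('a, 'c) cob1 =
  src1 :: "'a signed_set"
  tgt1 :: "'a signed_set"
  comps1 :: "'c set"
  lsrc1 :: "'a \<Rightarrow> 'c"
  ltgt1 :: "'a \<Rightarrow> 'c"

definition src_fibre :: "('a, 'c) cob1 \<Rightarrow> 'c \<Rightarrow> 'a set" where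
  "src_fibre K c = {a \<in> points (src1 K). lsrc1 K a = c}"

definition tgt_fibre :: "('a, 'c) cob1 \<Rightarrow> 'c \<Rightarrow> 'a set" where
  "tgt_fibre K c = {a \<in> points (tgt1 K). ltgt1 K a = c}"

definition is_cob1 :: "('a, 'c) cob1 \<Rightarrow> bool" where
  "is_cob1 K \<longleftrightarrow>
     src1 K \<in> finite_signed_sets \<and> tgt1 K \<in> finite_signed_sets \<and> finite (comps1 K) \<and>
     lsrc1 K ` points (src1 K) \<subseteq> comps1 K \<and> ltgt1 K ` points (tgt1 K) \<subseteq> comps1 K \<and>
     (\<forall>c\<in>comps1 K.
        (\<exists>a\<in>pos (src1 K). \<exists>b\<in>neg (src1 K). src_fibre K c = {a, b} \<and> tgt_fibre K c = {}) \<or>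
        (\<exists>a\<in>pos (tgt1 K). \<exists>b\<in>neg (tgt1 K). src_fibre K c = {} \<and> tgt_fibre K c = {a, b}) \<or>
        (\<exists>a\<in>pos (src1 K). \<exists>b\<in>pos (tgt1 K). src_fibre K c = {a} \<and> tgt_fibre K c = {b}) \<or>
        (\<exists>a\<in>neg (src1 K). \<exists>b\<in>neg (tgt1 K). src_fibre K c = {a} \<and> tgt_fibre K c = {b}) \<or>
        (src_fibre K c = {} \<and> tgt_fibre K c = {}))"

definition equiv1 :: "('a, 'c) cob1 \<Rightarrow> ('a, 'd) cob1 \<Rightarrow> bool" where
  "equiv1 K K' \<longleftrightarrow> src1 K = src1 K' \<and> tgt1 K = tgt1 K' \<and>
     (\<exists>h. bij_betw h (comps1 K) (comps1 K') \<and>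
        (\<forall>a\<in>points (src1 K). h (lsrc1 K a) = lsrc1 K' a) \<and>
        (\<forall>a\<in>points (tgt1 K). h (ltgt1 K a) = ltgt1 K' a))"

text \<open>Every finite set of components is in bijection with a set of natural numbers, so a morphism
  is represented by the set of all its presentations whose components are natural numbers.\<close>

definition class1 :: "('a, 'c) cob1 \<Rightarrow> ('a, nat) cob1 set" where
  "class1 K = {K'. equiv1 K K'}"

definition compose1 :: "('a, 'd) cob1 \<Rightarrow> ('a, 'c) cob1 \<Rightarrow> ('a, ('c + 'd) set) cob1" where
  "compose1 L K =
     (let M = points (tgt1 K); f = ltgt1 K; g = lsrc1 L in
      \<lparr>src1 = src1 K, tgt1 = tgt1 L,
       comps1 = pushout (comps1 K) (comps1 L) M f g,
       lsrc1 = pushout_inl M f g \<circ> lsrc1 K,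
       ltgt1 = pushout_inr M f g \<circ> ltgt1 L\<rparr>)"

definition id_cob1 :: "'a signed_set \<Rightarrow> ('a, 'a) cob1" where
  "id_cob1 m = \<lparr>src1 = m, tgt1 = m, comps1 = points m, lsrc1 = (\<lambda>a. a), ltgt1 = (\<lambda>a. a)\<rparr>"

definition one_Cob :: "('a signed_set, ('a, nat) cob1 set) cat" where
  "one_Cob =
     \<lparr>Ob = finite_signed_sets,
      Hom = (\<lambda>m n. {class1 K | K :: ('a, nat) cob1. is_cob1 K \<and> src1 K = m \<and> tgt1 K = n}),
      Id = (\<lambda>m. class1 (id_cob1 m)),
      cmp = (\<lambda>g f. \<Union>L\<in>g. \<Union>K\<in>f. class1 (compose1 L K))\<rparr>"


section \<open>Two-dimensional cobordisms\<close>

record ('a, 'c) cob2 =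
  src2 :: "'a set"
  tgt2 :: "'a set"
  comps2 :: "'c set"
  lsrc2 :: "'a \<Rightarrow> 'c"
  ltgt2 :: "'a \<Rightarrow> 'c"
  genus2 :: "'c \<Rightarrow> nat"

definition is_cob2 :: "('a, 'c) cob2 \<Rightarrow> bool" where
  "is_cob2 K \<longleftrightarrow> finite (src2 K) \<and> finite (tgt2 K) \<and> finite (comps2 K) \<and>
     lsrc2 K ` src2 K \<subseteq> comps2 K \<and> ltgt2 K ` tgt2 K \<subseteq> comps2 K"

definition equiv2 :: "('a, 'c) cob2 \<Rightarrow> ('a, 'd) cob2 \<Rightarrow> bool" where
  "equiv2 K K' \<longleftrightarrow> src2 K = src2 K' \<and> tgt2 K = tgt2 K' \<and>
     (\<exists>h. bij_betw h (comps2 K) (comps2 K') \<and>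
        (\<forall>a\<in>src2 K. h (lsrc2 K a) = lsrc2 K' a) \<and>
        (\<forall>a\<in>tgt2 K. h (ltgt2 K a) = ltgt2 K' a) \<and>
        (\<forall>c\<in>comps2 K. genus2 K' (h c) = genus2 K c))"

definition class2 :: "('a, 'c) cob2 \<Rightarrow> ('a, nat) cob2 set" where
  "class2 K = {K'. equiv2 K K'}"

text \<open>A component of the composite is obtained by gluing a connected family of components, so
  the integer below is nonnegative and \<open>nat\<close> does not truncate it.\<close>

definition compose2 :: "('a, 'd) cob2 \<Rightarrow> ('a, 'c) cob2 \<Rightarrow> ('a, ('c + 'd) set) cob2" where
  "compose2 L K =
     (let M = tgt2 K; f = ltgt2 K; g = lsrc2 L; \<iota>A = pushout_inl M f g; \<iota>B = pushout_inr M f g in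
      \<lparr>src2 = src2 K, tgt2 = tgt2 L,
       comps2 = pushout (comps2 K) (comps2 L) M f g,
       lsrc2 = \<iota>A \<circ> lsrc2 K,
       ltgt2 = \<iota>B \<circ> ltgt2 L,
       genus2 = (\<lambda>x. nat (1 + (\<Sum>a\<in>{a \<in> comps2 K. \<iota>A a = x}. int (genus2 K a) - 1)
                            + (\<Sum>b\<in>{b \<in> comps2 L. \<iota>B b = x}. int (genus2 L b) - 1)
                            + int (card {y \<in> M. \<iota>A (f y) = x})))\<rparr>)"

definition id_cob2 :: "'a set \<Rightarrow> ('a, 'a) cob2" where
  "id_cob2 m = \<lparr>src2 = m, tgt2 = m, comps2 = m, lsrc2 = (\<lambda>a. a), ltgt2 = (\<lambda>a. a),
     genus2 = (\<lambda>_. 0)\<rparr>"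

definition two_Cob :: "('a set, ('a, nat) cob2 set) cat" where
  "two_Cob =
     \<lparr>Ob = {m. finite m},
      Hom = (\<lambda>m n. {class2 K | K :: ('a, nat) cob2. is_cob2 K \<and> src2 K = m \<and> tgt2 K = n}),
      Id = (\<lambda>m. class2 (id_cob2 m)),
      cmp = (\<lambda>g f. \<Union>L\<in>g. \<Union>K\<in>f. class2 (compose2 L K))\<rparr>"

text \<open>The two conditions below are invariant under \<open>equiv2\<close>, so it does not matter which
  presentation of a morphism is used to test them.\<close>

definition cofibrations2 :: "('a, nat) cob2 set set" where
  "cofibrations2 = {F \<in> Arr two_Cob. \<exists>K\<in>F.
     inj_on (ltgt2 K) (tgt2 K) \<and>
     (\<exists>u. u ` tgt2 K \<subseteq> src2 K \<and> (\<forall>a\<in>tgt2 K. ltgt2 K a = lsrc2 K (u a)))}"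

definition fibrations2 :: "('a, nat) cob2 set set" where
  "fibrations2 = {F \<in> Arr two_Cob. \<exists>K\<in>F.
     inj_on (lsrc2 K) (src2 K) \<and>
     ltgt2 K ` tgt2 K = comps2 K \<and>
     (\<forall>a\<in>src2 K. genus2 K (lsrc2 K a) = 0)}"


section \<open>The comparison functor and the two classes of morphisms\<close>

text \<open>The object part of the comparison functor from \<open>one_Cob\<close> to \<open>two_Cob\<close> is \<open>points\<close>; its
  morphism part \<open>Phi\<close> takes the genus to be identically zero. (Gluing arcs into a closed circle
  produces genus 1 in \<open>two_Cob\<close>, so with this convention \<open>Phi\<close> respects composition only up to
  the genus of closed components. The two classes below do not depend on that genus: cofibrations
  ignore the genus, and fibrations have no closed components.)\<close>

definition forget_signs :: "('a, 'c) cob1 \<Rightarrow> ('a, 'c) cob2" where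
  "forget_signs K = \<lparr>src2 = points (src1 K), tgt2 = points (tgt1 K), comps2 = comps1 K,
     lsrc2 = lsrc1 K, ltgt2 = ltgt1 K, genus2 = (\<lambda>_. 0)\<rparr>"

definition Phi :: "('a, nat) cob1 set \<Rightarrow> ('a, nat) cob2 set" where
  "Phi f = (\<Union>K\<in>f. class2 (forget_signs K))"

definition cofibrations1 :: "('a, nat) cob1 set set" where
  "cofibrations1 = {f \<in> Arr one_Cob. Phi f \<in> cofibrations2}"

definition fibrations1 :: "('a, nat) cob1 set set" where
  "fibrations1 = {f \<in> Arr one_Cob. Phi f \<in> fibrations2}"

end

theory Submission
  imports Defs
begin

text \<open>A morphism of \<open>one_Cob\<close> is an isomorphism class of finite cospans \<open>m \<rightarrow> C \<leftarrow> n\<close> of sets, composed by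
  pushout, in which every component is an oriented arc or a closed loop. The factorization system comes
  from the cospans; the signs only have to be checked when a new cospan is built.

  A cofibration \<open>e : X \<rightarrow> Y\<close> embeds the points of \<open>Y\<close> into those of \<open>X\<close>: it consists of strands from \<open>X\<close>
  to \<open>Y\<close>, one for each point of \<open>Y\<close>, of caps on the remaining points of \<open>X\<close>, and of loops. A fibration
  \<open>r : X' \<rightarrow> Y'\<close> consists of strands, one for each point of \<open>X'\<close>, and of cups on the remaining points of
  \<open>Y'\<close>. Cutting a cobordism in the middle of its strands that run from source to target therefore factors
  it: caps and loops go to the first factor, cups to the second (\<open>factorization_cob1\<close>).

  For the lifting property, let \<open>v \<cdot> e = r \<cdot> u\<close> and let \<open>P\<close> be the set of components of this composite.
  Pushouts of injections are injective, so the components of \<open>u\<close> and those of \<open>v\<close> are subsets of \<open>P\<close>.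
  The components of \<open>P\<close> that are missing from \<open>v\<close> are the caps and loops of \<open>e\<close>, and those missing from \<open>u\<close>
  are the cups of \<open>r\<close>. The filler \<open>w : Y \<rightarrow> X'\<close> has to avoid both, and the intersection of the two subsets
  works: a pushout along \<open>e\<close> or \<open>r\<close> can be cut down to a subset of \<open>P\<close> (\<open>lifting_cob1\<close>, by
  \<open>pushout_square_restrict\<close>). It is unique because a cofibration is an epimorphism: \<open>w \<cdot> e\<close>
  determines how the boundary points of \<open>w\<close> are connected, and the number of components of \<open>w\<close>
  (\<open>cofib_cancel\<close>). Two cospans of finite sets for which these data agree are isomorphic.

  That oriented cobordisms form a category needs an argument about signs: a composite consists of arcs and
  loops again, because gluing arcs end to end gives chains, and a chain of finitely many arcs has an end if
  it has a beginning (\<open>composite_is_cob1\<close>). Associativity follows from the universal property of pushouts.\<close>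


section \<open>Pushout squares of sets\<close>

text \<open>The last clause says that every subset of \<open>A <+> B\<close> that is saturated for the gluing is the preimage of a
  subset of \<open>P\<close>. In sets this amounts to the universal property, as points are separated by subsets, that is,
  by maps to a two-element set. It replaces a quantification over all target types, and reachability along
  the gluing relation.\<close>

definition pushout_square ::
    "'c set \<Rightarrow> 'd set \<Rightarrow> 'a set \<Rightarrow> ('a \<Rightarrow> 'c) \<Rightarrow> ('a \<Rightarrow> 'd) \<Rightarrow> 'e set \<Rightarrow> ('c \<Rightarrow> 'e) \<Rightarrow> ('d \<Rightarrow> 'e) \<Rightarrow> bool"
  where
  "pushout_square A B M f g P i j \<longleftrightarrow>
     (\<forall>y\<in>M. i (f y) = j (g y)) \<and> P = i ` A \<union> j ` B \<and>
     (\<forall>U V. (\<forall>y\<in>M. f y \<in> U \<longleftrightarrow> g y \<in> V) \<longrightarrow>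
        (\<exists>W. (\<forall>a\<in>A. i a \<in> W \<longleftrightarrow> a \<in> U) \<and> (\<forall>b\<in>B. j b \<in> W \<longleftrightarrow> b \<in> V)))"

lemma pushout_square_commutes: "pushout_square A B M f g P i j \<Longrightarrow> y \<in> M \<Longrightarrow> i (f y) = j (g y)"
  by (simp add: pushout_square_def)

lemma pushout_square_cover: "pushout_square A B M f g P i j \<Longrightarrow> P = i ` A \<union> j ` B"
  by (simp add: pushout_square_def)

lemma pushout_square_separates:
  assumes "pushout_square A B M f g P i j" and "\<And>y. y \<in> M \<Longrightarrow> f y \<in> U \<longleftrightarrow> g y \<in> V"
  shows "\<exists>W. (\<forall>a\<in>A. i a \<in> W \<longleftrightarrow> a \<in> U) \<and> (\<forall>b\<in>B. j b \<in> W \<longleftrightarrow> b \<in> V)"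
proof -
  have "\<forall>y\<in>M. f y \<in> U \<longleftrightarrow> g y \<in> V"
    using assms(2) by blast
  then show ?thesis
    using assms(1) unfolding pushout_square_def by (elim conjE allE impE)
qed

lemma pushout_square_sym: "pushout_square A B M f g P i j \<Longrightarrow> pushout_square B A M g f P j i"
  unfolding pushout_square_def by (simp add: Un_commute) metis

text \<open>For \<open>b \<in> B\<close> the subset of \<open>A\<close> that matches \<open>{b}\<close> consists of the images under \<open>f\<close> of the preimages of \<open>b\<close>
  under \<open>g\<close>; it is injectivity of \<open>f\<close> that makes the two saturated.\<close>

lemma pushout_square_inj:
  assumes sq: "pushout_square A B M f g P i j" and inj: "inj_on f M"
  shows "inj_on j B"
proof (rule inj_onI)
  fix b b' assume b: "b \<in> B" "b' \<in> B" "j b = j b'"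
  have "f y \<in> {f z |z. z \<in> M \<and> g z = b} \<longleftrightarrow> g y \<in> {b}" if "y \<in> M" for y
    using inj that by (auto dest: inj_onD)
  then obtain W where "\<forall>b'\<in>B. j b' \<in> W \<longleftrightarrow> b' \<in> {b}"
    using pushout_square_separates[OF sq, of "{f z |z. z \<in> M \<and> g z = b}" "{b}"] by blast
  then show "b = b'"
    using b by (metis singletonD singletonI)
qed

text \<open>A point outside the image of \<open>f\<close> is a saturated subset by itself.\<close>

lemma pushout_square_unglued:
  assumes sq: "pushout_square A B M f g P i j" and a: "a \<in> A" "a \<notin> f ` M"
  shows "i a \<notin> j ` B" and "a' \<in> A \<Longrightarrow> i a' = i a \<Longrightarrow> a' = a"
proof -
  have "f y \<in> {a} \<longleftrightarrow> g y \<in> {}" if "y \<in> M" for y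
    using a that by auto
  then obtain W where W: "\<forall>a'\<in>A. i a' \<in> W \<longleftrightarrow> a' \<in> {a}" "\<forall>b\<in>B. j b \<in> W \<longleftrightarrow> b \<in> {}"
    using pushout_square_separates[OF sq, of "{a}" "{}"] by blast
  show "i a \<notin> j ` B"
  proof
    assume "i a \<in> j ` B"
    then obtain b where b: "b \<in> B" "i a = j b"
      by blast
    have "i a \<in> W" "j b \<notin> W"
      using W a(1) b(1) by blast+
    then show False
      using b(2) by simp
  qed
  show "a' = a" if "a' \<in> A" "i a' = i a"
  proof -
    have "i a \<in> W"
      using W(1) a(1) by blast
    then have "i a' \<in> W"
      using that(2) by simp
    then show ?thesis
      using W(1) that(1) by blast
  qed
qed

text \<open>A subset of the pushout that contains the image of \<open>A\<close> is again a pushout, of \<open>A\<close> and of a part of the image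
  of \<open>B\<close>. This is how the components of a lift are cut out of the composite that is to be filled.\<close>

lemma pushout_square_restrict:
  assumes sq: "pushout_square A B M f g P i j" and Q: "Q \<subseteq> P" "i ` A \<subseteq> Q" and g: "g ` M \<subseteq> B"
  shows "pushout_square A (Q \<inter> j ` B) M f (j \<circ> g) Q i (\<lambda>x. x)"
  unfolding pushout_square_def
proof (intro conjI allI impI ballI)
  show "i (f y) = (j \<circ> g) y" if "y \<in> M" for y
    using pushout_square_commutes[OF sq that] by simp
  show "Q = i ` A \<union> (\<lambda>x. x) ` (Q \<inter> j ` B)"
    using pushout_square_cover[OF sq] Q by auto
  fix U V assume UV: "\<forall>y\<in>M. f y \<in> U \<longleftrightarrow> (j \<circ> g) y \<in> V"
  have "f y \<in> U \<longleftrightarrow> g y \<in> {b \<in> B. j b \<in> V}" if "y \<in> M" for y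
    using UV that g by auto
  then obtain W where W: "\<forall>a\<in>A. i a \<in> W \<longleftrightarrow> a \<in> U" "\<forall>b\<in>B. j b \<in> W \<longleftrightarrow> b \<in> {b \<in> B. j b \<in> V}"
    using pushout_square_separates[OF sq, of U "{b \<in> B. j b \<in> V}"] by blast
  show "\<exists>W. (\<forall>a\<in>A. i a \<in> W \<longleftrightarrow> a \<in> U) \<and> (\<forall>b\<in>Q \<inter> j ` B. b \<in> W \<longleftrightarrow> b \<in> V)"
    by (rule exI[of _ W]) (use W in auto)
qed

lemma pushout_square_image:
  assumes sq: "pushout_square A B M f g P i j" and h: "inj_on h P"
  shows "pushout_square A B M f g (h ` P) (h \<circ> i) (h \<circ> j)"
  unfolding pushout_square_def
proof (intro conjI allI impI ballI)
  show "(h \<circ> i) (f y) = (h \<circ> j) (g y)" if "y \<in> M" for y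
    using pushout_square_commutes[OF sq that] by simp
  show "h ` P = (h \<circ> i) ` A \<union> (h \<circ> j) ` B"
    using pushout_square_cover[OF sq] by (simp add: image_Un image_comp)
  fix U V assume "\<forall>y\<in>M. f y \<in> U \<longleftrightarrow> g y \<in> V"
  then obtain W where W: "\<forall>a\<in>A. i a \<in> W \<longleftrightarrow> a \<in> U" "\<forall>b\<in>B. j b \<in> W \<longleftrightarrow> b \<in> V"
    using pushout_square_separates[OF sq, of U V] by blast
  have "h p \<in> h ` (W \<inter> P) \<longleftrightarrow> p \<in> W" if "p \<in> P" for p
    using h that by (auto dest: inj_onD)
  then show "\<exists>W. (\<forall>a\<in>A. (h \<circ> i) a \<in> W \<longleftrightarrow> a \<in> U) \<and> (\<forall>b\<in>B. (h \<circ> j) b \<in> W \<longleftrightarrow> b \<in> V)"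
    using W pushout_square_cover[OF sq] by (intro exI[of _ "h ` (W \<inter> P)"]) simp
qed

lemma pushout_square_reindex:
  assumes sq: "pushout_square A' B' M f' g' P i j"
    and h: "bij_betw h A A'" and k: "bij_betw k B B'"
    and f: "\<And>y. y \<in> M \<Longrightarrow> f y \<in> A \<and> h (f y) = f' y" and g: "\<And>y. y \<in> M \<Longrightarrow> g y \<in> B \<and> k (g y) = g' y"
  shows "pushout_square A B M f g P (i \<circ> h) (j \<circ> k)"
  unfolding pushout_square_def
proof (intro conjI allI impI ballI)
  show "(i \<circ> h) (f y) = (j \<circ> k) (g y)" if "y \<in> M" for y
    using pushout_square_commutes[OF sq that] f[OF that] g[OF that] by simp
  show "P = (i \<circ> h) ` A \<union> (j \<circ> k) ` B"
    unfolding image_comp[symmetric] bij_betw_imp_surj_on[OF h] bij_betw_imp_surj_on[OF k]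
    by (rule pushout_square_cover[OF sq])
  fix U V assume UV: "\<forall>y\<in>M. f y \<in> U \<longleftrightarrow> g y \<in> V"
  have hU: "h a \<in> h ` (U \<inter> A) \<longleftrightarrow> a \<in> U" if "a \<in> A" for a
    using h that by (auto simp: bij_betw_def dest: inj_onD)
  have kV: "k b \<in> k ` (V \<inter> B) \<longleftrightarrow> b \<in> V" if "b \<in> B" for b
    using k that by (auto simp: bij_betw_def dest: inj_onD)
  have "f' y \<in> h ` (U \<inter> A) \<longleftrightarrow> g' y \<in> k ` (V \<inter> B)" if "y \<in> M" for y
    using UV that f[OF that] g[OF that] hU[of "f y"] kV[of "g y"] by simp
  then obtain W where "\<forall>a\<in>A'. i a \<in> W \<longleftrightarrow> a \<in> h ` (U \<inter> A)" "\<forall>b\<in>B'. j b \<in> W \<longleftrightarrow> b \<in> k ` (V \<inter> B)"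
    using pushout_square_separates[OF sq, of "h ` (U \<inter> A)" "k ` (V \<inter> B)"] by blast
  then have "(\<forall>a\<in>A. (i \<circ> h) a \<in> W \<longleftrightarrow> a \<in> U) \<and> (\<forall>b\<in>B. (j \<circ> k) b \<in> W \<longleftrightarrow> b \<in> V)"
    using hU kV bij_betwE[OF h] bij_betwE[OF k] by simp
  then show "\<exists>W. (\<forall>a\<in>A. (i \<circ> h) a \<in> W \<longleftrightarrow> a \<in> U) \<and> (\<forall>b\<in>B. (j \<circ> k) b \<in> W \<longleftrightarrow> b \<in> V)"
    by blast
qed

text \<open>Two pushouts of the same maps make the same identifications: the fibre in \<open>A <+> B\<close> of a point of the
  second pushout is saturated, hence a union of fibres over the first.\<close>

lemma pushout_square_kernel:
  assumes sq: "pushout_square A B M f g P i j"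
    and sq': "pushout_square A B M f g P' i' j'"
    and xy: "x \<in> A <+> B" "y \<in> A <+> B" "case_sum i j x = case_sum i j y"
  shows "case_sum i' j' x = case_sum i' j' y"
proof -
  let ?t = "case_sum i' j'"
  obtain W where W: "\<forall>a\<in>A. i a \<in> W \<longleftrightarrow> a \<in> {a. i' a = ?t x}" "\<forall>b\<in>B. j b \<in> W \<longleftrightarrow> b \<in> {b. j' b = ?t x}"
    using pushout_square_separates[OF sq, of "{a. i' a = ?t x}" "{b. j' b = ?t x}"]
      pushout_square_commutes[OF sq'] by auto
  have "case_sum i j z \<in> W \<longleftrightarrow> ?t z = ?t x" if "z \<in> A <+> B" for z
    using W that by (elim PlusE) simp_all
  from this[OF xy(1)] this[OF xy(2)] show ?thesis
    using xy(3) by simp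
qed

text \<open>Two pushouts in a row have the universal property of the colimit of the whole zigzag
  \<open>A \<leftarrow> M \<rightarrow> B \<leftarrow> N \<rightarrow> C\<close>, which no longer depends on the order in which they were formed.\<close>

lemma iterated_pushout_separates:
  assumes sq: "pushout_square A B M f g P i j" and sq': "pushout_square P C N u g' Q i' j'"
    and u: "\<And>z. z \<in> N \<Longrightarrow> f' z \<in> B \<and> u z = j (f' z)"
    and UV: "\<And>y. y \<in> M \<Longrightarrow> f y \<in> U \<longleftrightarrow> g y \<in> V" and VX: "\<And>z. z \<in> N \<Longrightarrow> f' z \<in> V \<longleftrightarrow> g' z \<in> X"
  shows "\<exists>W. (\<forall>a\<in>A. i' (i a) \<in> W \<longleftrightarrow> a \<in> U) \<and> (\<forall>b\<in>B. i' (j b) \<in> W \<longleftrightarrow> b \<in> V) \<and>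
    (\<forall>c\<in>C. j' c \<in> W \<longleftrightarrow> c \<in> X)"
proof -
  obtain W where W: "\<forall>a\<in>A. i a \<in> W \<longleftrightarrow> a \<in> U" "\<forall>b\<in>B. j b \<in> W \<longleftrightarrow> b \<in> V"
    using pushout_square_separates[OF sq, of U V] UV by blast
  have "u z \<in> W \<longleftrightarrow> g' z \<in> X" if "z \<in> N" for z
    using W(2) u[OF that] VX[OF that] by simp
  then obtain W' where "\<forall>p\<in>P. i' p \<in> W' \<longleftrightarrow> p \<in> W" "\<forall>c\<in>C. j' c \<in> W' \<longleftrightarrow> c \<in> X"
    using pushout_square_separates[OF sq', of W X] by blast
  then show ?thesis
    using W pushout_square_cover[OF sq] by (intro exI[of _ W']) simp
qed

text \<open>A pushout along an injection \<open>f\<close> adds to \<open>B\<close> the points of \<open>A\<close> outside the image of \<open>f\<close>.\<close>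

lemma pushout_square_card:
  assumes sq: "pushout_square A B M f g P i j" and inj: "inj_on f M" and fin: "finite A" "finite B"
    and g: "g ` M \<subseteq> B"
  shows "card P = card (A - f ` M) + card B"
proof -
  have "i a \<in> i ` (A - f ` M) \<union> j ` B" if "a \<in> A" for a
    using that pushout_square_commutes[OF sq] g by (cases "a \<in> f ` M") auto
  then have "P = i ` (A - f ` M) \<union> j ` B"
    using pushout_square_cover[OF sq] by blast
  moreover have "i ` (A - f ` M) \<inter> j ` B = {}"
    using pushout_square_unglued(1)[OF sq] by blast
  moreover have "inj_on i (A - f ` M)"
    using pushout_square_unglued(2)[OF sq] by (metis DiffE inj_onI)
  ultimately show ?thesis
    using fin pushout_square_inj[OF sq inj] by (simp add: card_Un_disjoint card_image)
qed

lemma glue_saturated: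
  assumes "(x, y) \<in> glue M f g" and "\<And>y. y \<in> M \<Longrightarrow> f y \<in> U \<longleftrightarrow> g y \<in> V"
  shows "x \<in> U <+> V \<longleftrightarrow> y \<in> U <+> V"
  using assms(1) unfolding glue_def Let_def
  by (induction rule: rtrancl_induct) (use assms(2) in auto)

lemma pushout_square_pushout:
  "pushout_square A B M f g (pushout A B M f g) (pushout_inl M f g) (pushout_inr M f g)"
  unfolding pushout_square_def
proof (intro conjI allI impI ballI)
  have eq: "equiv UNIV (glue M f g)"
    unfolding glue_def Let_def
    by (intro equivI refl_rtrancl trans_rtrancl sym_rtrancl) (auto simp: sym_def)
  show "pushout_inl M f g (f y) = pushout_inr M f g (g y)" if "y \<in> M" for y
    unfolding pushout_inl_def pushout_inr_def
    by (rule equiv_class_eq[OF eq]) (use that in \<open>auto simp: glue_def Let_def\<close>)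
  show "pushout A B M f g = pushout_inl M f g ` A \<union> pushout_inr M f g ` B"
    unfolding pushout_def pushout_inl_def pushout_inr_def quotient_def by auto
  fix U V assume UV: "\<forall>y\<in>M. f y \<in> U \<longleftrightarrow> g y \<in> V"
  let ?W = "{x. \<exists>z\<in>x. z \<in> U <+> V}"
  have "glue M f g `` {x} \<in> ?W \<longleftrightarrow> x \<in> U <+> V" for x
  proof -
    have "(x, x) \<in> glue M f g"
      by (simp add: glue_def Let_def)
    then show ?thesis
      using glue_saturated[of x _ M f g U V] UV by blast
  qed
  then have "(\<forall>a\<in>A. pushout_inl M f g a \<in> ?W \<longleftrightarrow> a \<in> U) \<and> (\<forall>b\<in>B. pushout_inr M f g b \<in> ?W \<longleftrightarrow> b \<in> V)"
    unfolding pushout_inl_def pushout_inr_def by blast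
  then show "\<exists>W. (\<forall>a\<in>A. pushout_inl M f g a \<in> W \<longleftrightarrow> a \<in> U) \<and> (\<forall>b\<in>B. pushout_inr M f g b \<in> W \<longleftrightarrow> b \<in> V)"
    by blast
qed

lemma bij_betw_images_of_same_kernel:
  assumes "\<And>x y. x \<in> S \<Longrightarrow> y \<in> S \<Longrightarrow> s x = s y \<longleftrightarrow> t x = t y"
  obtains h where "bij_betw h (s ` S) (t ` S)" and "\<And>x. x \<in> S \<Longrightarrow> h (s x) = t x"
proof
  let ?h = "\<lambda>p. t (inv_into S s p)"
  show h: "?h (s x) = t x" if "x \<in> S" for x
    using assms that by (metis f_inv_into_f imageI inv_into_into)
  show "bij_betw ?h (s ` S) (t ` S)"
    unfolding bij_betw_def inj_on_def image_image using h assms by (auto simp: image_iff)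
qed

text \<open>For jointly labelled finite sets, an isomorphism exists as soon as the labels make the same identifications
  and the numbers of points agree. The unlabelled points, here closed loops, may be matched arbitrarily.\<close>

lemma bij_betw_extending_same_kernel:
  assumes ker: "\<And>x y. x \<in> S \<Longrightarrow> y \<in> S \<Longrightarrow> s x = s y \<longleftrightarrow> t x = t y"
    and fin: "finite C" "finite D" "card C = card D" and sub: "s ` S \<subseteq> C" "t ` S \<subseteq> D"
  obtains h where "bij_betw h C D" and "\<And>x. x \<in> S \<Longrightarrow> h (s x) = t x"
proof -
  obtain h where h: "bij_betw h (s ` S) (t ` S)" "\<And>x. x \<in> S \<Longrightarrow> h (s x) = t x"
    using bij_betw_images_of_same_kernel[of S s t] ker by blast
  have "card (C - s ` S) = card (D - t ` S)"
    using bij_betw_same_card[OF h(1)] fin sub by (simp add: card_Diff_subset finite_subset)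
  then obtain k where k: "bij_betw k (C - s ` S) (D - t ` S)"
    using fin by (metis finite_Diff finite_same_card_bij)
  let ?h = "\<lambda>c. if c \<in> s ` S then h c else k c"
  have "bij_betw ?h (s ` S) (t ` S)"
    by (rule bij_betw_cong[THEN iffD1, OF _ h(1)]) simp
  moreover have "bij_betw ?h (C - s ` S) (D - t ` S)"
    by (rule bij_betw_cong[THEN iffD1, OF _ k]) simp
  ultimately have "bij_betw ?h (s ` S \<union> (C - s ` S)) (t ` S \<union> (D - t ` S))"
    by (rule bij_betw_combine) blast
  moreover have "s ` S \<union> (C - s ` S) = C" "t ` S \<union> (D - t ` S) = D"
    using sub by auto
  ultimately show ?thesis
    using that[of ?h] h(2) by simp
qed


section \<open>Presentations of cobordisms and their equivalence\<close>

lemma equiv1_refl: "equiv1 K K"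
  unfolding equiv1_def by (auto intro!: exI[of _ "\<lambda>x. x"] simp: bij_betw_def)

lemma equiv1I:
  assumes "src1 K = src1 K'" "tgt1 K = tgt1 K'" "bij_betw h (comps1 K) (comps1 K')"
    and "\<And>a. a \<in> points (src1 K) \<Longrightarrow> h (lsrc1 K a) = lsrc1 K' a"
    and "\<And>b. b \<in> points (tgt1 K) \<Longrightarrow> h (ltgt1 K b) = ltgt1 K' b"
  shows "equiv1 K K'"
  unfolding equiv1_def using assms by blast

lemma equiv1E:
  assumes "equiv1 K K'"
  obtains h where "bij_betw h (comps1 K) (comps1 K')"
    and "\<And>a. a \<in> points (src1 K) \<Longrightarrow> h (lsrc1 K a) = lsrc1 K' a"
    and "\<And>b. b \<in> points (tgt1 K) \<Longrightarrow> h (ltgt1 K b) = ltgt1 K' b"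
    and "src1 K' = src1 K" "tgt1 K' = tgt1 K"
  using assms unfolding equiv1_def by metis

lemma equiv1_trans:
  assumes "equiv1 K L" "equiv1 L P"
  shows "equiv1 K P"
proof -
  obtain h where h: "bij_betw h (comps1 K) (comps1 L)"
      "\<And>a. a \<in> points (src1 K) \<Longrightarrow> h (lsrc1 K a) = lsrc1 L a"
      "\<And>b. b \<in> points (tgt1 K) \<Longrightarrow> h (ltgt1 K b) = ltgt1 L b"
      "src1 L = src1 K" "tgt1 L = tgt1 K"
    using assms(1) by (rule equiv1E) blast
  obtain k where k: "bij_betw k (comps1 L) (comps1 P)"
      "\<And>a. a \<in> points (src1 L) \<Longrightarrow> k (lsrc1 L a) = lsrc1 P a"
      "\<And>b. b \<in> points (tgt1 L) \<Longrightarrow> k (ltgt1 L b) = ltgt1 P b"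
      "src1 P = src1 L" "tgt1 P = tgt1 L"
    using assms(2) by (rule equiv1E) blast
  show ?thesis
    by (rule equiv1I[of _ _ "k \<circ> h"]) (use h k in \<open>simp_all add: bij_betw_trans\<close>)
qed

lemma is_cob1_labels:
  assumes "is_cob1 K"
  shows "a \<in> points (src1 K) \<Longrightarrow> lsrc1 K a \<in> comps1 K"
    and "b \<in> points (tgt1 K) \<Longrightarrow> ltgt1 K b \<in> comps1 K"
    and "finite (comps1 K)"
  using assms unfolding is_cob1_def by auto

lemma is_cob1_cases:
  assumes "is_cob1 K" and "c \<in> comps1 K"
  shows "(\<exists>a\<in>pos (src1 K). \<exists>b\<in>neg (src1 K). src_fibre K c = {a, b} \<and> tgt_fibre K c = {}) \<or>
     (\<exists>a\<in>pos (tgt1 K). \<exists>b\<in>neg (tgt1 K). src_fibre K c = {} \<and> tgt_fibre K c = {a, b}) \<or>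
     (\<exists>a\<in>pos (src1 K). \<exists>b\<in>pos (tgt1 K). src_fibre K c = {a} \<and> tgt_fibre K c = {b}) \<or>
     (\<exists>a\<in>neg (src1 K). \<exists>b\<in>neg (tgt1 K). src_fibre K c = {a} \<and> tgt_fibre K c = {b}) \<or>
     (src_fibre K c = {} \<and> tgt_fibre K c = {})"
  using assms by (simp only: is_cob1_def)

lemma is_cob1_equiv1:
  assumes K: "is_cob1 K" and eq: "equiv1 K K'"
  shows "is_cob1 K'"
proof -
  obtain h where h: "bij_betw h (comps1 K) (comps1 K')"
      "\<And>a. a \<in> points (src1 K) \<Longrightarrow> h (lsrc1 K a) = lsrc1 K' a"
      "\<And>b. b \<in> points (tgt1 K) \<Longrightarrow> h (ltgt1 K b) = ltgt1 K' b"
    and st [simp]: "src1 K' = src1 K" "tgt1 K' = tgt1 K"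
    using eq by (rule equiv1E) blast
  have inj: "h c = h d \<longleftrightarrow> c = d" if "c \<in> comps1 K" "d \<in> comps1 K" for c d
    using h(1) that by (meson bij_betw_def inj_on_eq_iff)
  have fibre: "src_fibre K' (h c) = src_fibre K c \<and> tgt_fibre K' (h c) = tgt_fibre K c"
    if c: "c \<in> comps1 K" for c
  proof -
    have "lsrc1 K' a = h c \<longleftrightarrow> lsrc1 K a = c" if "a \<in> points (src1 K)" for a
      using h(2)[OF that] inj[OF is_cob1_labels(1)[OF K that] c] by simp
    moreover have "ltgt1 K' b = h c \<longleftrightarrow> ltgt1 K b = c" if "b \<in> points (tgt1 K)" for b
      using h(3)[OF that] inj[OF is_cob1_labels(2)[OF K that] c] by simp
    ultimately show ?thesis
      unfolding src_fibre_def tgt_fibre_def st by blast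
  qed
  have im: "comps1 K' = h ` comps1 K"
    using h(1) by (simp add: bij_betw_def)
  have "lsrc1 K' ` points (src1 K) \<subseteq> h ` comps1 K" "ltgt1 K' ` points (tgt1 K) \<subseteq> h ` comps1 K"
    using h(2,3)[symmetric] is_cob1_labels(1,2)[OF K] by auto
  then show ?thesis
    using K unfolding is_cob1_def im ball_simps st by (simp add: fibre)
qed

lemma equiv1_sym:
  assumes K: "is_cob1 K" and eq: "equiv1 K K'"
  shows "equiv1 K' K"
proof -
  obtain h where h: "bij_betw h (comps1 K) (comps1 K')"
      "\<And>a. a \<in> points (src1 K) \<Longrightarrow> h (lsrc1 K a) = lsrc1 K' a"
      "\<And>a. a \<in> points (tgt1 K) \<Longrightarrow> h (ltgt1 K a) = ltgt1 K' a"
    using eq unfolding equiv1_def by auto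
  let ?k = "inv_into (comps1 K) h"
  have "?k (h c) = c" if "c \<in> comps1 K" for c
    using h(1) that by (simp add: bij_betw_inv_into_left)
  then have "?k (lsrc1 K' a) = lsrc1 K a" if "a \<in> points (src1 K)" for a
    using h(2) is_cob1_labels(1)[OF K] that by metis
  moreover have "?k (ltgt1 K' a) = ltgt1 K a" if "a \<in> points (tgt1 K)" for a
    using h(1,3) is_cob1_labels(2)[OF K] that by (metis bij_betw_inv_into_left)
  ultimately show ?thesis
    using eq bij_betw_inv_into[OF h(1)] unfolding equiv1_def by (intro conjI exI[of _ ?k]) auto
qed

definition relabel :: "('c \<Rightarrow> 'd) \<Rightarrow> ('a, 'c) cob1 \<Rightarrow> ('a, 'd) cob1" where
  "relabel h K = \<lparr>src1 = src1 K, tgt1 = tgt1 K, comps1 = h ` comps1 K,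
     lsrc1 = h \<circ> lsrc1 K, ltgt1 = h \<circ> ltgt1 K\<rparr>"

lemma equiv1_relabel: "inj_on h (comps1 K) \<Longrightarrow> equiv1 K (relabel h K)"
  unfolding equiv1_def relabel_def by (auto intro!: exI[of _ h] simp: bij_betw_def)

lemma nat_presentation:
  assumes "is_cob1 K"
  obtains K' :: "('a, nat) cob1" where "equiv1 K K'" and "is_cob1 K'"
  using equiv1_relabel[of _ K] is_cob1_equiv1[OF assms] finite_imp_inj_to_nat_seg is_cob1_labels(3)[OF assms]
  by metis

text \<open>A class contains a presentation by natural numbers because the set of components is finite. If classes could
  be empty, inequivalent presentations would share the empty one.\<close>

lemma class1_eq_iff:
  assumes K: "is_cob1 K" and K': "is_cob1 K'"
  shows "class1 K = class1 K' \<longleftrightarrow> equiv1 K K'"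
proof
  assume "class1 K = class1 K'"
  moreover obtain Q :: "('a, nat) cob1" where "equiv1 K Q"
    using nat_presentation[OF K] .
  ultimately have "equiv1 K' Q"
    by (auto simp: class1_def)
  then show "equiv1 K K'"
    using \<open>equiv1 K Q\<close> equiv1_sym[OF K'] equiv1_trans by metis
next
  assume "equiv1 K K'"
  moreover from this have "equiv1 K' K"
    by (rule equiv1_sym[OF K])
  ultimately show "class1 K = class1 K'"
    unfolding class1_def by (metis equiv1_trans)
qed


section \<open>Incoming and outgoing ends\<close>

text \<open>Orient the arcs so that they come in at positive points of the source and at negative points of the target,
  and go out at the other points. The four types of arcs are then the four ways in which one incoming end can
  be joined to one outgoing end.\<close>

definition in_ends :: "('a, 'c) cob1 \<Rightarrow> ('a + 'a) set" where
  "in_ends K = Inl ` pos (src1 K) \<union> Inr ` neg (tgt1 K)"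

definition out_ends :: "('a, 'c) cob1 \<Rightarrow> ('a + 'a) set" where
  "out_ends K = Inl ` neg (src1 K) \<union> Inr ` pos (tgt1 K)"

definition label :: "('a, 'c) cob1 \<Rightarrow> 'a + 'a \<Rightarrow> 'c" where
  "label K = case_sum (lsrc1 K) (ltgt1 K)"

lemma label_simps [simp]: "label K (Inl a) = lsrc1 K a" "label K (Inr b) = ltgt1 K b"
  by (simp_all add: label_def)

text \<open>This is the condition on the components of an oriented cobordism, with its five cases combined: the ends of a
  component are either one incoming and one outgoing end, or there are none.\<close>

definition balanced :: "('a, 'c) cob1 \<Rightarrow> bool" where
  "balanced K \<longleftrightarrow> inj_on (label K) (in_ends K) \<and> inj_on (label K) (out_ends K) \<and>
     label K ` in_ends K = label K ` out_ends K"

definition cospan :: "('a, 'c) cob1 \<Rightarrow> bool" where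
  "cospan K \<longleftrightarrow> src1 K \<in> finite_signed_sets \<and> tgt1 K \<in> finite_signed_sets \<and> finite (comps1 K) \<and>
     lsrc1 K ` points (src1 K) \<subseteq> comps1 K \<and> ltgt1 K ` points (tgt1 K) \<subseteq> comps1 K"

lemma cospan_label: "cospan K \<Longrightarrow> e \<in> in_ends K \<union> out_ends K \<Longrightarrow> label K e \<in> comps1 K"
  unfolding cospan_def in_ends_def out_ends_def points_def by auto

lemma cospan_labels:
  assumes "cospan K"
  shows "a \<in> points (src1 K) \<Longrightarrow> lsrc1 K a \<in> comps1 K"
    and "b \<in> points (tgt1 K) \<Longrightarrow> ltgt1 K b \<in> comps1 K"
    and "finite (comps1 K)"
  using assms unfolding cospan_def by auto

text \<open>As no point has both signs, every point of a fibre is an end of exactly one kind.\<close>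

lemma is_cob1_balanced:
  assumes K: "is_cob1 K"
  shows "balanced K"
proof -
  let ?I = "\<lambda>c. {e \<in> in_ends K. label K e = c}" and ?O = "\<lambda>c. {e \<in> out_ends K. label K e = c}"
  have disj: "neg (src1 K) \<inter> pos (src1 K) = {}" "neg (tgt1 K) \<inter> pos (tgt1 K) = {}"
    using K by (auto simp: is_cob1_def finite_signed_sets_def)
  have fibres: "?I c = {} \<and> ?O c = {} \<or> (\<exists>e e'. ?I c = {e} \<and> ?O c = {e'})" if c: "c \<in> comps1 K" for c
  proof -
    have I: "?I c = Inl ` (src_fibre K c \<inter> pos (src1 K)) \<union> Inr ` (tgt_fibre K c \<inter> neg (tgt1 K))"
      and O: "?O c = Inl ` (src_fibre K c \<inter> neg (src1 K)) \<union> Inr ` (tgt_fibre K c \<inter> pos (tgt1 K))"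
      unfolding in_ends_def out_ends_def src_fibre_def tgt_fibre_def points_def by auto
    have sign: "{a, b} \<inter> pos m = {a}" "{a, b} \<inter> neg m = {b}"
      if "a \<in> pos m" "b \<in> neg m" "neg m \<inter> pos m = {}" for a b :: 'a and m
      using that by auto
    have sign1: "{a} \<inter> pos m = {a}" "{a} \<inter> neg m = {}" if "a \<in> pos m" "neg m \<inter> pos m = {}" for a :: 'a and m
      using that by auto
    have sign2: "{a} \<inter> neg m = {a}" "{a} \<inter> pos m = {}" if "a \<in> neg m" "neg m \<inter> pos m = {}" for a :: 'a and m
      using that by auto
    show ?thesis
      unfolding I O using is_cob1_cases[OF K c]
      by (elim disjE bexE conjE) (simp_all add: sign sign1 sign2 disj)
  qed
  have labels: "label K e \<in> comps1 K" if "e \<in> in_ends K \<union> out_ends K" for e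
    using cospan_label[OF _ that] K by (simp add: cospan_def is_cob1_def)
  have single: "\<exists>e e'. ?I (label K x) = {e} \<and> ?O (label K x) = {e'}" if "x \<in> in_ends K \<union> out_ends K" for x
    using fibres[OF labels[OF that]] that by auto
  have "x = y" if xy: "x \<in> in_ends K" "y \<in> in_ends K" "label K y = label K x" for x y
  proof -
    obtain e where e: "?I (label K x) = {e}"
      using single[OF UnI1[OF xy(1)]] by blast
    have "x \<in> ?I (label K x)" "y \<in> ?I (label K x)"
      using xy by simp_all
    then show ?thesis
      unfolding e by simp
  qed
  moreover have "x = y" if xy: "x \<in> out_ends K" "y \<in> out_ends K" "label K y = label K x" for x y
  proof -
    obtain e where e: "?O (label K x) = {e}"
      using single[OF UnI2[OF xy(1)]] by blast
    have "x \<in> ?O (label K x)" "y \<in> ?O (label K x)"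
      using xy by simp_all
    then show ?thesis
      unfolding e by simp
  qed
  moreover have "label K x \<in> label K ` out_ends K" if x: "x \<in> in_ends K" for x
  proof -
    obtain e' where "?O (label K x) = {e'}"
      using single[of x] x by blast
    then have "e' \<in> ?O (label K x)"
      by simp
    then show ?thesis
      by (intro rev_image_eqI[of e']) simp_all
  qed
  moreover have "label K x \<in> label K ` in_ends K" if x: "x \<in> out_ends K" for x
  proof -
    obtain e where "?I (label K x) = {e}"
      using single[of x] x by blast
    then have "e \<in> ?I (label K x)"
      by simp
    then show ?thesis
      by (intro rev_image_eqI[of e]) simp_all
  qed
  ultimately show ?thesis
    unfolding balanced_def inj_on_def by (metis image_subsetI subset_antisym)
qed

text \<open>In this form the conditions on a cospan built from others reduce to identities between sets of components.\<close>

lemma balanced_iff: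
  "balanced K \<longleftrightarrow>
     inj_on (lsrc1 K) (pos (src1 K)) \<and> inj_on (lsrc1 K) (neg (src1 K)) \<and>
     inj_on (ltgt1 K) (pos (tgt1 K)) \<and> inj_on (ltgt1 K) (neg (tgt1 K)) \<and>
     lsrc1 K ` pos (src1 K) \<inter> ltgt1 K ` neg (tgt1 K) = {} \<and>
     lsrc1 K ` neg (src1 K) \<inter> ltgt1 K ` pos (tgt1 K) = {} \<and>
     lsrc1 K ` pos (src1 K) \<union> ltgt1 K ` neg (tgt1 K) = lsrc1 K ` neg (src1 K) \<union> ltgt1 K ` pos (tgt1 K)"
proof -
  have "inj_on (label K) (Inl ` A \<union> Inr ` B) \<longleftrightarrow>
      inj_on (lsrc1 K) A \<and> inj_on (ltgt1 K) B \<and> lsrc1 K ` A \<inter> ltgt1 K ` B = {}" for A B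
  proof -
    have "inj_on (label K) (Inl ` A) \<longleftrightarrow> inj_on (lsrc1 K) A" "inj_on (label K) (Inr ` B) \<longleftrightarrow> inj_on (ltgt1 K) B"
      by (auto simp: inj_on_def)
    moreover have "Inl ` A - Inr ` B = Inl ` A" "Inr ` B - Inl ` A = Inr ` B"
      by auto
    ultimately show ?thesis
      by (simp add: inj_on_Un image_image)
  qed
  then show ?thesis
    unfolding balanced_def in_ends_def out_ends_def by (auto simp: image_Un image_image)
qed

lemma balanced_is_cob1:
  assumes K: "cospan K" and bal: "balanced K"
  shows "is_cob1 K"
  unfolding is_cob1_def
proof (intro conjI ballI)
  show "src1 K \<in> finite_signed_sets" "tgt1 K \<in> finite_signed_sets" "finite (comps1 K)"
    "lsrc1 K ` points (src1 K) \<subseteq> comps1 K" "ltgt1 K ` points (tgt1 K) \<subseteq> comps1 K"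
    using K by (simp_all add: cospan_def)
  fix c
  show "(\<exists>a\<in>pos (src1 K). \<exists>b\<in>neg (src1 K). src_fibre K c = {a, b} \<and> tgt_fibre K c = {}) \<or>
        (\<exists>a\<in>pos (tgt1 K). \<exists>b\<in>neg (tgt1 K). src_fibre K c = {} \<and> tgt_fibre K c = {a, b}) \<or>
        (\<exists>a\<in>pos (src1 K). \<exists>b\<in>pos (tgt1 K). src_fibre K c = {a} \<and> tgt_fibre K c = {b}) \<or>
        (\<exists>a\<in>neg (src1 K). \<exists>b\<in>neg (tgt1 K). src_fibre K c = {a} \<and> tgt_fibre K c = {b}) \<or>
        (src_fibre K c = {} \<and> tgt_fibre K c = {})"
  proof (cases "c \<in> label K ` in_ends K")
    case False
    then have "c \<notin> label K ` in_ends K" "c \<notin> label K ` out_ends K"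
      using bal by (simp_all add: balanced_def)
    then have "src_fibre K c = {}" "tgt_fibre K c = {}"
      unfolding src_fibre_def tgt_fibre_def points_def in_ends_def out_ends_def image_Un image_image
      by auto
    then show ?thesis
      by blast
  next
    case True
    then obtain e e' where e: "e \<in> in_ends K" "label K e = c" and e': "e' \<in> out_ends K" "label K e' = c"
      using bal unfolding balanced_def by (metis imageE)
    have "x = e" if "x \<in> in_ends K" "label K x = c" for x
      using bal e that by (auto simp: balanced_def dest: inj_onD)
    moreover have "x = e'" if "x \<in> out_ends K" "label K x = c" for x
      using bal e' that by (auto simp: balanced_def dest: inj_onD)
    ultimately have u: "a \<in> pos (src1 K) \<Longrightarrow> lsrc1 K a = c \<Longrightarrow> Inl a = e"
        "a \<in> neg (tgt1 K) \<Longrightarrow> ltgt1 K a = c \<Longrightarrow> Inr a = e"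
        "a \<in> neg (src1 K) \<Longrightarrow> lsrc1 K a = c \<Longrightarrow> Inl a = e'"
        "a \<in> pos (tgt1 K) \<Longrightarrow> ltgt1 K a = c \<Longrightarrow> Inr a = e'" for a
      unfolding in_ends_def out_ends_def by auto
    from e(1) e'(1) consider
        (cap) a b where "a \<in> pos (src1 K)" "b \<in> neg (src1 K)" "e = Inl a" "e' = Inl b"
      | (cup) a b where "a \<in> pos (tgt1 K)" "b \<in> neg (tgt1 K)" "e = Inr b" "e' = Inr a"
      | (plus) a b where "a \<in> pos (src1 K)" "b \<in> pos (tgt1 K)" "e = Inl a" "e' = Inr b"
      | (minus) a b where "a \<in> neg (src1 K)" "b \<in> neg (tgt1 K)" "e = Inr b" "e' = Inl a"
      unfolding in_ends_def out_ends_def by blast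
    then show ?thesis
    proof cases
      case (cap a b)
      have "src_fibre K c = {a, b}" "tgt_fibre K c = {}"
        using cap(1,2) e(2) e'(2) unfolding src_fibre_def tgt_fibre_def points_def cap(3,4)
        by (auto dest: u[unfolded cap(3,4)])
      then show ?thesis using cap by blast
    next
      case (cup a b)
      have "src_fibre K c = {}" "tgt_fibre K c = {a, b}"
        using cup(1,2) e(2) e'(2) unfolding src_fibre_def tgt_fibre_def points_def cup(3,4)
        by (auto dest: u[unfolded cup(3,4)])
      then show ?thesis using cup by blast
    next
      case (plus a b)
      have "src_fibre K c = {a}" "tgt_fibre K c = {b}"
        using plus(1,2) e(2) e'(2) unfolding src_fibre_def tgt_fibre_def points_def plus(3,4)
        by (auto dest: u[unfolded plus(3,4)])
      then show ?thesis using plus by blast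
    next
      case (minus a b)
      have "src_fibre K c = {a}" "tgt_fibre K c = {b}"
        using minus(1,2) e(2) e'(2) unfolding src_fibre_def tgt_fibre_def points_def minus(3,4)
        by (auto dest: u[unfolded minus(3,4)])
      then show ?thesis using minus by blast
    qed
  qed
qed

lemma is_cob1_cospan: "is_cob1 K \<Longrightarrow> cospan K"
  by (simp add: is_cob1_def cospan_def)


section \<open>Chains of glued components\<close>

text \<open>In this section the relation \<open>r\<close> is to be thought of as a partial injection, with \<open>(x, y) \<in> r\<close> when the outgoing
  end of \<open>x\<close> is glued to the incoming end of \<open>y\<close>.\<close>

text \<open>The elements reachable from a start are closed under predecessors as well, because predecessors are unique
  and the start has none. So reachability in one direction gives a saturated set.\<close>

lemma chain_from_start:
  assumes inj: "single_valued (r\<inverse>)" and x: "x \<notin> Range r"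
    and zw: "(z, w) \<in> r"
  shows "(x, z) \<in> r\<^sup>* \<longleftrightarrow> (x, w) \<in> r\<^sup>*"
proof
  show "(x, w) \<in> r\<^sup>*" if "(x, z) \<in> r\<^sup>*"
    using that zw by (rule rtrancl_into_rtrancl)
next
  assume "(x, w) \<in> r\<^sup>*"
  then show "(x, z) \<in> r\<^sup>*"
  proof (cases rule: rtranclE)
    case base
    then show ?thesis using x zw by blast
  next
    case (step v)
    then have "v = z"
      using inj zw by (auto dest: single_valuedD)
    then show ?thesis using step by simp
  qed
qed

text \<open>Otherwise the successor function would map the finite set of elements reachable from \<open>x\<close> injectively into
  itself without reaching \<open>x\<close>.\<close>

lemma chain_has_end:
  assumes fin: "finite r" and sv: "single_valued r" and inj: "single_valued (r\<inverse>)" and x: "x \<notin> Range r"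
  shows "\<exists>y. (x, y) \<in> r\<^sup>* \<and> y \<notin> Domain r"
proof (rule ccontr)
  assume no_end: "\<not> (\<exists>y. (x, y) \<in> r\<^sup>* \<and> y \<notin> Domain r)"
  let ?U = "r\<^sup>* `` {x}"
  have "?U \<subseteq> insert x (Range r)"
    by (auto elim: rtranclE)
  then have finU: "finite ?U"
    using fin by (meson finite_Range finite_insert finite_subset)
  have dom: "\<exists>w. (z, w) \<in> r" if "z \<in> ?U" for z
    using no_end that by blast
  then obtain s where s: "\<And>z. z \<in> ?U \<Longrightarrow> (z, s z) \<in> r"
    by metis
  have "inj_on s ?U"
    using s inj unfolding inj_on_def by (metis converse_iff single_valuedD)
  moreover have "s ` ?U \<subseteq> ?U - {x}"
    using s x by (auto intro: rtrancl_into_rtrancl)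
  ultimately have "card ?U \<le> card (?U - {x})"
    using finU by (metis card_inj_on_le finite_Diff)
  moreover have "card (?U - {x}) < card ?U"
    using finU by (intro psubset_card_mono) auto
  ultimately show False
    by simp
qed

text \<open>Distinct starts are not identified, because the elements reachable from one of them form a saturated set that
  contains no other start. Every start is identified with the end of its chain.\<close>

lemma chain_quotient:
  assumes fin: "finite r" and sv: "single_valued r" and inj: "single_valued (r\<inverse>)" and T: "Field r \<subseteq> T"
    and glued: "\<And>x y. (x, y) \<in> r \<Longrightarrow> s x = s y"
    and separates: "\<And>U. (\<And>x y. (x, y) \<in> r \<Longrightarrow> x \<in> U \<longleftrightarrow> y \<in> U) \<Longrightarrow> \<exists>W. \<forall>x\<in>T. s x \<in> W \<longleftrightarrow> x \<in> U"
  shows "inj_on s (T - Range r)" and "s ` (T - Range r) \<subseteq> s ` (T - Domain r)"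
proof -
  show "inj_on s (T - Range r)"
  proof (rule inj_onI)
    fix x y assume x: "x \<in> T - Range r" and y: "y \<in> T - Range r" and eq: "s x = s y"
    have "z \<in> r\<^sup>* `` {x} \<longleftrightarrow> w \<in> r\<^sup>* `` {x}" if "(z, w) \<in> r" for z w
      using chain_from_start[OF inj _ that, of x] x by simp
    then obtain W where W: "\<forall>z\<in>T. s z \<in> W \<longleftrightarrow> z \<in> r\<^sup>* `` {x}"
      using separates[of "r\<^sup>* `` {x}"] by blast
    have "s x \<in> W"
      using W x by blast
    then have "(x, y) \<in> r\<^sup>*"
      using W y eq by auto
    then show "x = y"
      using y by (auto elim: rtranclE)
  qed
  show "s ` (T - Range r) \<subseteq> s ` (T - Domain r)"
  proof
    fix p assume "p \<in> s ` (T - Range r)"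
    then obtain x where x: "x \<in> T" "x \<notin> Range r" "p = s x"
      by blast
    obtain y where y: "(x, y) \<in> r\<^sup>*" "y \<notin> Domain r"
      using chain_has_end[OF fin sv inj x(2)] by blast
    have "s y = s x \<and> y \<in> T"
      using y(1)
    proof (induction rule: rtrancl_induct)
      case base
      then show ?case using x by simp
    next
      case (step y z)
      then show ?case using glued[of y z] T by (auto simp: Field_def)
    qed
    then show "p \<in> s ` (T - Domain r)"
      using x(3) y(2) by (metis DiffI image_eqI)
  qed
qed


section \<open>Composites of presentations\<close>

text \<open>This relation says that \<open>P\<close> presents the composite of \<open>K\<close> and \<open>L\<close>, for any set of components: it can be transported
  along isomorphisms in all three places, which the construction \<open>compose1\<close> on chosen pushouts cannot.\<close>

definition composite ::
    "('a, 'c) cob1 \<Rightarrow> ('a, 'd) cob1 \<Rightarrow> ('a, 'e) cob1 \<Rightarrow> ('c \<Rightarrow> 'e) \<Rightarrow> ('d \<Rightarrow> 'e) \<Rightarrow> bool" where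
  "composite K L P i j \<longleftrightarrow>
     tgt1 K = src1 L \<and> src1 P = src1 K \<and> tgt1 P = tgt1 L \<and>
     pushout_square (comps1 K) (comps1 L) (points (src1 L)) (ltgt1 K) (lsrc1 L) (comps1 P) i j \<and>
     (\<forall>a\<in>points (src1 K). lsrc1 P a = i (lsrc1 K a)) \<and>
     (\<forall>b\<in>points (tgt1 L). ltgt1 P b = j (ltgt1 L b))"

lemma compositeD:
  assumes "composite K L P i j"
  shows "tgt1 K = src1 L" "src1 P = src1 K" "tgt1 P = tgt1 L"
    and "pushout_square (comps1 K) (comps1 L) (points (src1 L)) (ltgt1 K) (lsrc1 L) (comps1 P) i j"
    and "a \<in> points (src1 K) \<Longrightarrow> lsrc1 P a = i (lsrc1 K a)"
    and "b \<in> points (tgt1 L) \<Longrightarrow> ltgt1 P b = j (ltgt1 L b)"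
  using assms unfolding composite_def by blast+

lemma composite_compose1:
  "tgt1 K = src1 L \<Longrightarrow> \<exists>i j. composite K L (compose1 L K) i j"
  unfolding composite_def compose1_def Let_def
  by (intro exI[of _ "pushout_inl (points (tgt1 K)) (ltgt1 K) (lsrc1 L)"]
      exI[of _ "pushout_inr (points (tgt1 K)) (ltgt1 K) (lsrc1 L)"])
    (simp add: pushout_square_pushout)

lemma composite_relabelled:
  assumes comp: "composite K L P i j" and eq: "equiv1 P P'"
  shows "\<exists>i j. composite K L P' i j"
proof -
  note D = compositeD[OF comp]
  obtain h where h: "bij_betw h (comps1 P) (comps1 P')"
      "\<And>a. a \<in> points (src1 P) \<Longrightarrow> h (lsrc1 P a) = lsrc1 P' a"
      "\<And>b. b \<in> points (tgt1 P) \<Longrightarrow> h (ltgt1 P b) = ltgt1 P' b"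
      "src1 P' = src1 P" "tgt1 P' = tgt1 P"
    using eq by (rule equiv1E) blast
  have "composite K L P' (h \<circ> i) (h \<circ> j)"
    using pushout_square_image[OF D(4), of h] h D(1-3) D(5,6)[symmetric]
    unfolding composite_def by (simp add: bij_betw_def)
  then show ?thesis
    by blast
qed

lemma composite_equiv_factors:
  assumes comp: "composite K' L' P i j" and K: "cospan K" "equiv1 K K'" and L: "cospan L" "equiv1 L L'"
  shows "\<exists>i j. composite K L P i j"
proof -
  note D = compositeD[OF comp]
  obtain h where h: "bij_betw h (comps1 K) (comps1 K')"
      "\<And>a. a \<in> points (src1 K) \<Longrightarrow> h (lsrc1 K a) = lsrc1 K' a"
      "\<And>b. b \<in> points (tgt1 K) \<Longrightarrow> h (ltgt1 K b) = ltgt1 K' b"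
      "src1 K' = src1 K" "tgt1 K' = tgt1 K"
    using K(2) by (rule equiv1E) blast
  obtain k where k: "bij_betw k (comps1 L) (comps1 L')"
      "\<And>a. a \<in> points (src1 L) \<Longrightarrow> k (lsrc1 L a) = lsrc1 L' a"
      "\<And>b. b \<in> points (tgt1 L) \<Longrightarrow> k (ltgt1 L b) = ltgt1 L' b"
      "src1 L' = src1 L" "tgt1 L' = tgt1 L"
    using L(2) by (rule equiv1E) blast
  have st: "tgt1 K = src1 L"
    using D(1) h(5) k(4) by simp
  have "pushout_square (comps1 K) (comps1 L) (points (src1 L)) (ltgt1 K) (lsrc1 L) (comps1 P) (i \<circ> h) (j \<circ> k)"
  proof (rule pushout_square_reindex[OF D(4)[unfolded k(4)] h(1) k(1)])
    fix y assume "y \<in> points (src1 L)"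
    then show "ltgt1 K y \<in> comps1 K \<and> h (ltgt1 K y) = ltgt1 K' y"
      "lsrc1 L y \<in> comps1 L \<and> k (lsrc1 L y) = lsrc1 L' y"
      using h(3) k(2) K(1) L(1) st by (auto simp: cospan_def)
  qed
  then have "composite K L P (i \<circ> h) (j \<circ> k)"
    using st D(2,3) D(5,6) h k unfolding composite_def by simp
  then show ?thesis
    by blast
qed

lemma composite_unique:
  assumes P: "composite K L P i j" and P': "composite K L P' i' j'" and K: "cospan K" and L: "cospan L"
  shows "equiv1 P P'"
proof -
  note D = compositeD[OF P] and D' = compositeD[OF P']
  let ?S = "comps1 K <+> comps1 L" and ?s = "case_sum i j" and ?t = "case_sum i' j'"
  have "?s x = ?s y \<longleftrightarrow> ?t x = ?t y" if "x \<in> ?S" "y \<in> ?S" for x y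
    using pushout_square_kernel[OF D(4) D'(4) that] pushout_square_kernel[OF D'(4) D(4) that] by blast
  then obtain h where h: "bij_betw h (?s ` ?S) (?t ` ?S)" "\<And>x. x \<in> ?S \<Longrightarrow> h (?s x) = ?t x"
    using bij_betw_images_of_same_kernel[of ?S ?s ?t] by blast
  have "?s ` ?S = comps1 P" "?t ` ?S = comps1 P'"
    using pushout_square_cover[OF D(4)] pushout_square_cover[OF D'(4)]
    by (simp_all add: Plus_def image_Un image_image)
  then have bij: "bij_betw h (comps1 P) (comps1 P')"
    using h(1) by simp
  show ?thesis
  proof (rule equiv1I[OF _ _ bij])
    show "src1 P = src1 P'" "tgt1 P = tgt1 P'"
      using D(2,3) D'(2,3) by simp_all
    show "h (lsrc1 P a) = lsrc1 P' a" if "a \<in> points (src1 P)" for a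
      using h(2)[OF InlI[OF cospan_labels(1)[OF K]]] D(2,5) D'(5) that by simp
    show "h (ltgt1 P b) = ltgt1 P' b" if "b \<in> points (tgt1 P)" for b
      using h(2)[OF InrI[OF cospan_labels(2)[OF L]]] D(3,6) D'(6) that by simp
  qed
qed

text \<open>Both iterated composites are colimits of the same zigzag, so that they identify the same components of \<open>K\<close>,
  \<open>L\<close> and \<open>M\<close>.\<close>

lemma composite_assoc:
  assumes P: "composite K L P i j" and Q: "composite P M Q i' j'"
    and R: "composite L M R k l" and T: "composite K R T k' l'"
    and cospans: "cospan K" "cospan L" "cospan M"
  shows "equiv1 Q T"
proof -
  note P = compositeD[OF P] and Q = compositeD[OF Q] and R = compositeD[OF R] and T = compositeD[OF T]
  let ?A = "comps1 K" and ?B = "comps1 L" and ?C = "comps1 M"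
  let ?S = "?A <+> (?B <+> ?C)"
  let ?s = "case_sum (i' \<circ> i) (case_sum (i' \<circ> j) j')" and ?t = "case_sum k' (case_sum (l' \<circ> k) (l' \<circ> l))"
  have L: "y \<in> points (src1 L) \<Longrightarrow> lsrc1 L y \<in> ?B" "z \<in> points (src1 M) \<Longrightarrow> ltgt1 L z \<in> ?B" for y z
    using cospans(2) R(1) by (auto simp: cospan_def)
  have sepQ: "\<exists>W. (\<forall>a\<in>?A. i' (i a) \<in> W \<longleftrightarrow> a \<in> U) \<and> (\<forall>b\<in>?B. i' (j b) \<in> W \<longleftrightarrow> b \<in> V) \<and>
      (\<forall>c\<in>?C. j' c \<in> W \<longleftrightarrow> c \<in> X)"
    if "\<And>y. y \<in> points (src1 L) \<Longrightarrow> ltgt1 K y \<in> U \<longleftrightarrow> lsrc1 L y \<in> V"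
      "\<And>z. z \<in> points (src1 M) \<Longrightarrow> ltgt1 L z \<in> V \<longleftrightarrow> lsrc1 M z \<in> X" for U V X
    by (rule iterated_pushout_separates[OF P(4) Q(4), of "ltgt1 L"]) (use that L P(6) R(1) in auto)
  have sepT: "\<exists>W. (\<forall>c\<in>?C. l' (l c) \<in> W \<longleftrightarrow> c \<in> X) \<and> (\<forall>b\<in>?B. l' (k b) \<in> W \<longleftrightarrow> b \<in> V) \<and>
      (\<forall>a\<in>?A. k' a \<in> W \<longleftrightarrow> a \<in> U)"
    if "\<And>y. y \<in> points (src1 L) \<Longrightarrow> ltgt1 K y \<in> U \<longleftrightarrow> lsrc1 L y \<in> V"
      "\<And>z. z \<in> points (src1 M) \<Longrightarrow> ltgt1 L z \<in> V \<longleftrightarrow> lsrc1 M z \<in> X" for U V X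
    by (rule iterated_pushout_separates[OF pushout_square_sym[OF R(4)] pushout_square_sym[OF T(4)],
          of "lsrc1 L"]) (use that L R(2,5) in auto)
  have commQ: "y \<in> points (src1 L) \<Longrightarrow> i' (i (ltgt1 K y)) = i' (j (lsrc1 L y))"
      "z \<in> points (src1 M) \<Longrightarrow> i' (j (ltgt1 L z)) = j' (lsrc1 M z)" for y z
    using pushout_square_commutes[OF P(4)] pushout_square_commutes[OF Q(4)] P(6) R(1) by auto
  have commT: "y \<in> points (src1 L) \<Longrightarrow> k' (ltgt1 K y) = l' (k (lsrc1 L y))"
      "z \<in> points (src1 M) \<Longrightarrow> l' (k (ltgt1 L z)) = l' (l (lsrc1 M z))" for y z
    using pushout_square_commutes[OF R(4)] pushout_square_commutes[OF T(4)] R(2,5) by auto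
  have "?t x = ?t y" if "x \<in> ?S" "y \<in> ?S" and eq: "?s x = ?s y" for x y
  proof -
    obtain W where W: "\<forall>a\<in>?A. i' (i a) \<in> W \<longleftrightarrow> k' a = ?t x" "\<forall>b\<in>?B. i' (j b) \<in> W \<longleftrightarrow> l' (k b) = ?t x"
        "\<forall>c\<in>?C. j' c \<in> W \<longleftrightarrow> l' (l c) = ?t x"
      using sepQ[of "{a. k' a = ?t x}" "{b. l' (k b) = ?t x}" "{c. l' (l c) = ?t x}"] commT by auto
    have "?s z \<in> W \<longleftrightarrow> ?t z = ?t x" if "z \<in> ?S" for z
      using W that by (elim PlusE) simp_all
    from this[OF that(1)] this[OF that(2)] show ?thesis
      using eq by simp
  qed
  moreover have "?s x = ?s y" if "x \<in> ?S" "y \<in> ?S" and eq: "?t x = ?t y" for x y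
  proof -
    obtain W where W: "\<forall>a\<in>?A. k' a \<in> W \<longleftrightarrow> i' (i a) = ?s x" "\<forall>b\<in>?B. l' (k b) \<in> W \<longleftrightarrow> i' (j b) = ?s x"
        "\<forall>c\<in>?C. l' (l c) \<in> W \<longleftrightarrow> j' c = ?s x"
      using sepT[of "{a. i' (i a) = ?s x}" "{b. i' (j b) = ?s x}" "{c. j' c = ?s x}"] commQ by auto
    have "?t z \<in> W \<longleftrightarrow> ?s z = ?s x" if "z \<in> ?S" for z
      using W that by (elim PlusE) simp_all
    from this[OF that(1)] this[OF that(2)] show ?thesis
      using eq by simp
  qed
  ultimately have "?s x = ?s y \<longleftrightarrow> ?t x = ?t y" if "x \<in> ?S" "y \<in> ?S" for x y
    using that by blast
  then obtain h where h: "bij_betw h (?s ` ?S) (?t ` ?S)" "\<And>x. x \<in> ?S \<Longrightarrow> h (?s x) = ?t x"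
    using bij_betw_images_of_same_kernel[of ?S ?s ?t] by blast
  have "?s ` ?S = comps1 Q" "?t ` ?S = comps1 T"
    using pushout_square_cover[OF P(4)] pushout_square_cover[OF Q(4)]
      pushout_square_cover[OF R(4)] pushout_square_cover[OF T(4)]
    by (simp_all add: Plus_def image_Un image_image Un_assoc)
  then have bij: "bij_betw h (comps1 Q) (comps1 T)"
    using h(1) by simp
  show ?thesis
  proof (rule equiv1I[OF _ _ bij])
    show "src1 Q = src1 T" "tgt1 Q = tgt1 T"
      using P(2,3) Q(2,3) R(2,3) T(2,3) by simp_all
    show "h (lsrc1 Q a) = lsrc1 T a" if "a \<in> points (src1 Q)" for a
      using h(2)[OF InlI[OF cospan_labels(1)[OF cospans(1)]]] P(2,5) Q(2,5) T(5) that by simp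
    show "h (ltgt1 Q b) = ltgt1 T b" if "b \<in> points (tgt1 Q)" for b
      using h(2)[OF InrI[OF InrI[OF cospan_labels(2)[OF cospans(3)]]]] Q(3,6) R(3,6) T(6) that by simp
  qed
qed

lemma composite_id_left: "cospan L \<Longrightarrow> src1 L = m \<Longrightarrow> composite (id_cob1 m) L L (lsrc1 L) (\<lambda>c. c)"
  unfolding composite_def id_cob1_def pushout_square_def cospan_def by auto

lemma composite_id_right: "cospan K \<Longrightarrow> tgt1 K = n \<Longrightarrow> composite K (id_cob1 n) K (\<lambda>c. c) (ltgt1 K)"
  unfolding composite_def id_cob1_def pushout_square_def cospan_def by auto

lemma composite_cospan:
  assumes comp: "composite K L P i j" and K: "cospan K" and L: "cospan L"
  shows "cospan P"
proof -
  note D = compositeD[OF comp]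
  have cover: "comps1 P = i ` comps1 K \<union> j ` comps1 L"
    by (rule pushout_square_cover[OF D(4)])
  have "lsrc1 P ` points (src1 P) \<subseteq> comps1 P" "ltgt1 P ` points (tgt1 P) \<subseteq> comps1 P"
    unfolding cover D(2,3) using D(5,6) cospan_labels[OF K] cospan_labels[OF L] by auto
  then show ?thesis
    using K L D(2,3) unfolding cospan_def by (simp add: cover)
qed

text \<open>A positive point of the middle object is an outgoing end of \<open>K\<close> and an incoming end of \<open>L\<close>, and a negative
  one the reverse. So composition glues arcs along a partial injection \<open>r\<close>, the arcs of the composite are chains
  of arcs, and their ends are the ends of arcs of \<open>K\<close> and \<open>L\<close> that are left free by the gluing. The reversed
  relation exchanges starts and ends of chains.\<close>

lemma composite_is_cob1:
  fixes K :: "('a, 'c) cob1" and L :: "('a, 'd) cob1"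
  assumes comp: "composite K L P i j" and K: "is_cob1 K" and L: "is_cob1 L"
  shows "is_cob1 P"
proof (rule balanced_is_cob1)
  show "cospan P"
    by (rule composite_cospan[OF comp is_cob1_cospan[OF K] is_cob1_cospan[OF L]])
  note D = compositeD[OF comp]
  define Y where "Y = src1 L"
  have Y: "tgt1 K = Y" "src1 L = Y"
    using D(1) by (simp_all add: Y_def)
  have KL: "balanced K" "balanced L"
    using is_cob1_balanced K L by blast+
  then have injK: "inj_on (label K) (in_ends K)" "inj_on (label K) (out_ends K)"
    and injL: "inj_on (label L) (in_ends L)" "inj_on (label L) (out_ends L)"
    by (simp_all add: balanced_def)
  define r where "r = (\<lambda>y. (Inl (ltgt1 K y), Inr (lsrc1 L y))) ` pos Y \<union>
    (\<lambda>y. (Inr (lsrc1 L y), Inl (ltgt1 K y))) ` neg Y"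
  define T where "T = Inl ` label K ` in_ends K \<union> Inr ` label L ` in_ends L"
  have T_out: "T = Inl ` label K ` out_ends K \<union> Inr ` label L ` out_ends L"
    using KL unfolding T_def balanced_def by simp
  let ?s = "case_sum i j"
  have "src1 L \<in> finite_signed_sets"
    using L by (simp add: is_cob1_def)
  then have fin: "finite r"
    unfolding r_def Y_def finite_signed_sets_def by simp
  have eqs: "y \<in> pos Y \<Longrightarrow> y' \<in> pos Y \<Longrightarrow> ltgt1 K y = ltgt1 K y' \<Longrightarrow> y = y'"
      "y \<in> pos Y \<Longrightarrow> y' \<in> pos Y \<Longrightarrow> lsrc1 L y = lsrc1 L y' \<Longrightarrow> y = y'"
      "y \<in> neg Y \<Longrightarrow> y' \<in> neg Y \<Longrightarrow> ltgt1 K y = ltgt1 K y' \<Longrightarrow> y = y'"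
      "y \<in> neg Y \<Longrightarrow> y' \<in> neg Y \<Longrightarrow> lsrc1 L y = lsrc1 L y' \<Longrightarrow> y = y'" for y y'
    using inj_onD[OF injK(2), of "Inr y" "Inr y'"] inj_onD[OF injL(1), of "Inl y" "Inl y'"]
      inj_onD[OF injK(1), of "Inr y" "Inr y'"] inj_onD[OF injL(2), of "Inl y" "Inl y'"]
    by (auto simp: in_ends_def out_ends_def Y)
  have sv: "single_valued r" "single_valued (r\<inverse>)"
    unfolding r_def single_valued_def by (auto dest: eqs)
  have field: "Field r \<subseteq> T"
  proof -
    have "Domain r \<subseteq> T"
      unfolding T_out r_def out_ends_def Y by (auto simp: image_Un image_image)
    moreover have "Range r \<subseteq> T"
      unfolding T_def r_def in_ends_def Y by (auto simp: image_Un image_image)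
    ultimately show ?thesis
      by (simp add: Field_def)
  qed
  have glued: "?s x = ?s y" if "(x, y) \<in> r" for x y
    using that pushout_square_commutes[OF D(4)] unfolding r_def Y_def points_def by auto
  have TAB: "T \<subseteq> comps1 K <+> comps1 L"
    unfolding T_def Plus_def
    using cospan_label[OF is_cob1_cospan[OF K]] cospan_label[OF is_cob1_cospan[OF L]]
    by (intro Un_mono image_mono) auto
  have separates: "\<exists>W. \<forall>x\<in>T. ?s x \<in> W \<longleftrightarrow> x \<in> U" if U: "\<And>x y. (x, y) \<in> r \<Longrightarrow> x \<in> U \<longleftrightarrow> y \<in> U" for U
  proof -
    have "Inl (ltgt1 K y) \<in> U \<longleftrightarrow> Inr (lsrc1 L y) \<in> U" if "y \<in> points (src1 L)" for y
      using that U[of "Inl (ltgt1 K y)" "Inr (lsrc1 L y)"] U[of "Inr (lsrc1 L y)" "Inl (ltgt1 K y)"]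
      unfolding r_def Y_def points_def by blast
    then obtain W where W: "\<forall>a\<in>comps1 K. i a \<in> W \<longleftrightarrow> a \<in> {a. Inl a \<in> U}"
        "\<forall>b\<in>comps1 L. j b \<in> W \<longleftrightarrow> b \<in> {b. Inr b \<in> U}"
      using pushout_square_separates[OF D(4), of "{a. Inl a \<in> U}" "{b. Inr b \<in> U}"] by auto
    have "?s x \<in> W \<longleftrightarrow> x \<in> U" if "x \<in> comps1 K <+> comps1 L" for x
      using W that by (elim PlusE) simp_all
    then show ?thesis
      using TAB by blast
  qed
  have chains: "inj_on ?s (T - Range r)" "?s ` (T - Range r) \<subseteq> ?s ` (T - Domain r)"
    by (rule chain_quotient[OF fin sv field glued separates]; assumption)+
  have chains': "inj_on ?s (T - Domain r)" "?s ` (T - Domain r) \<subseteq> ?s ` (T - Range r)"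
    using chain_quotient[of "r\<inverse>" T ?s] fin sv field glued[symmetric] separates by simp_all
  (* The component of K or L on which an end of the composite lies. *)
  let ?n = "map_sum (lsrc1 K) (ltgt1 L)"
  have lab: "label P e = ?s (?n e)" if "e \<in> in_ends P \<union> out_ends P" for e
    using that D(2,3,5,6) unfolding in_ends_def out_ends_def points_def by auto
  have apart: "a \<in> pos (src1 K) \<Longrightarrow> y \<in> neg Y \<Longrightarrow> lsrc1 K a \<noteq> ltgt1 K y"
      "a \<in> neg (src1 K) \<Longrightarrow> y \<in> pos Y \<Longrightarrow> lsrc1 K a \<noteq> ltgt1 K y"
      "b \<in> neg (tgt1 L) \<Longrightarrow> y \<in> pos Y \<Longrightarrow> ltgt1 L b \<noteq> lsrc1 L y"
      "b \<in> pos (tgt1 L) \<Longrightarrow> y \<in> neg Y \<Longrightarrow> ltgt1 L b \<noteq> lsrc1 L y" for a b y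
    using inj_onD[OF injK(1), of "Inl a" "Inr y"] inj_onD[OF injK(2), of "Inl a" "Inr y"]
      inj_onD[OF injL(1), of "Inr b" "Inl y"] inj_onD[OF injL(2), of "Inr b" "Inl y"]
    by (auto simp: in_ends_def out_ends_def Y)
  have starts: "?n ` in_ends P = T - Range r"
    unfolding T_def r_def in_ends_def D(2,3) Y using apart by (fastforce simp: image_Un image_image)
  have stops: "?n ` out_ends P = T - Domain r"
    unfolding T_out r_def out_ends_def D(2,3) Y using apart by (fastforce simp: image_Un image_image)
  have inj_n: "inj_on ?n (in_ends P)" "inj_on ?n (out_ends P)"
  proof -
    have "inj_on (lsrc1 K) (pos (src1 K))" "inj_on (lsrc1 K) (neg (src1 K))"
        "inj_on (ltgt1 L) (pos (tgt1 L))" "inj_on (ltgt1 L) (neg (tgt1 L))"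
      using KL unfolding balanced_iff by blast+
    moreover have "inj_on (map_sum f g) (Inl ` A \<union> Inr ` B)" if "inj_on f A" "inj_on g B"
      for f :: "'a \<Rightarrow> 'c" and g :: "'a \<Rightarrow> 'd" and A B
      using that by (intro inj_onI) (auto dest: inj_onD)
    ultimately show "inj_on ?n (in_ends P)" "inj_on ?n (out_ends P)"
      unfolding in_ends_def out_ends_def D(2,3) by blast+
  qed
  have labels: "label P ` in_ends P = ?s ` (T - Range r)" "label P ` out_ends P = ?s ` (T - Domain r)"
    unfolding starts[symmetric] stops[symmetric] image_image using lab by (auto intro!: image_cong)
  have "inj_on (\<lambda>e. ?s (?n e)) (in_ends P)" "inj_on (\<lambda>e. ?s (?n e)) (out_ends P)"
    using comp_inj_on[OF inj_n(1), of ?s] comp_inj_on[OF inj_n(2), of ?s] chains(1) chains'(1) starts stops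
    by (simp_all add: comp_def)
  moreover have "inj_on (label P) E \<longleftrightarrow> inj_on (\<lambda>e. ?s (?n e)) E" if "E \<subseteq> in_ends P \<union> out_ends P" for E
    by (rule inj_on_cong) (use lab that in blast)
  ultimately show "balanced P"
    unfolding balanced_def labels using chains(2) chains'(2) by simp
qed


section \<open>The category of oriented cobordisms\<close>

lemma one_Cob_simps [simp]:
  "Ob one_Cob = finite_signed_sets"
  "Id one_Cob m = class1 (id_cob1 m)"
  by (simp_all add: one_Cob_def)

lemma Hom_one_CobE:
  fixes f :: "('a, nat) cob1 set"
  assumes "f \<in> Hom one_Cob m n"
  obtains K :: "('a, nat) cob1" where "f = class1 K" "is_cob1 K" "src1 K = m" "tgt1 K = n"
  using assms unfolding one_Cob_def by auto

lemma class1_Hom: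
  assumes "is_cob1 K" "src1 K = m" "tgt1 K = n"
  shows "class1 K \<in> Hom one_Cob m n"
proof -
  obtain K' :: "('a, nat) cob1" where K': "equiv1 K K'" "is_cob1 K'"
    using nat_presentation[OF assms(1)] .
  then have "class1 K = class1 K'"
    using class1_eq_iff[OF assms(1)] by blast
  moreover have "src1 K' = m" "tgt1 K' = n"
    using K'(1) assms(2,3) by (simp_all add: equiv1_def)
  ultimately show ?thesis
    using K'(2) unfolding one_Cob_def by auto
qed

lemma class1_Hom_unique:
  assumes "is_cob1 K" "class1 K \<in> Hom one_Cob m n"
  shows "src1 K = m" "tgt1 K = n"
proof -
  obtain K' :: "('a, nat) cob1" where "class1 K = class1 K'" "is_cob1 K'" "src1 K' = m" "tgt1 K' = n"
    using assms(2) by (rule Hom_one_CobE)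
  then show "src1 K = m" "tgt1 K = n"
    using class1_eq_iff[OF assms(1)] by (auto simp: equiv1_def)
qed

text \<open>Composition in \<open>one_Cob\<close> is a union over all pairs of presentations, and all pairs contribute the same class.\<close>

lemma cmp_class1:
  fixes K :: "('a, 'c) cob1" and L :: "('a, 'd) cob1"
  assumes comp: "composite K L P i j" and K: "is_cob1 K" and L: "is_cob1 L"
  shows "cmp one_Cob (class1 L) (class1 K) = class1 P"
proof -
  note cospans = is_cob1_cospan[OF K] is_cob1_cospan[OF L]
  note P = composite_is_cob1[OF comp K L]
  have "class1 (compose1 L' K') = class1 P" if "L' \<in> class1 L" "K' \<in> class1 K" for L' K'
  proof -
    have eq: "equiv1 L L'" "equiv1 K K'"
      using that by (simp_all add: class1_def)
    then have "tgt1 K' = src1 L'"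
      using compositeD(1)[OF comp] by (simp add: equiv1_def)
    then obtain i' j' where "composite K' L' (compose1 L' K') i' j'"
      using composite_compose1 by blast
    then obtain i'' j'' where comp': "composite K L (compose1 L' K') i'' j''"
      using composite_equiv_factors[OF _ cospans(1) eq(2) cospans(2) eq(1)] by blast
    show ?thesis
      using class1_eq_iff composite_is_cob1[OF comp' K L] P composite_unique[OF comp' comp cospans] by blast
  qed
  moreover have "class1 K \<noteq> {}"
  proof -
    obtain K' :: "('a, nat) cob1" where "equiv1 K K'"
      using nat_presentation[OF K] .
    then show ?thesis
      by (auto simp: class1_def)
  qed
  moreover have "class1 L \<noteq> {}"
  proof -
    obtain L' :: "('a, nat) cob1" where "equiv1 L L'"
      using nat_presentation[OF L] .
    then show ?thesis
      by (auto simp: class1_def)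
  qed
  ultimately show ?thesis
    unfolding one_Cob_def by auto
qed

text \<open>Equations between morphisms thus become statements about pushout squares of presentations.\<close>

lemma cmp_class1_iff:
  fixes K :: "('a, 'c) cob1" and L :: "('a, 'd) cob1"
  assumes K: "is_cob1 K" and L: "is_cob1 L" and P: "is_cob1 P" and st: "tgt1 K = src1 L"
  shows "cmp one_Cob (class1 L) (class1 K) = class1 P \<longleftrightarrow> (\<exists>i j. composite K L P i j)"
proof
  assume eq: "cmp one_Cob (class1 L) (class1 K) = class1 P"
  obtain i j where comp: "composite K L (compose1 L K) i j"
    using composite_compose1[OF st] by blast
  then have "class1 (compose1 L K) = class1 P"
    using cmp_class1[OF comp K L] eq by simp
  then have "equiv1 (compose1 L K) P"
    using class1_eq_iff composite_is_cob1[OF comp K L] P by blast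
  then show "\<exists>i j. composite K L P i j"
    by (rule composite_relabelled[OF comp])
qed (use cmp_class1[OF _ K L] in blast)

lemma id_cob1_is_cob1: "m \<in> finite_signed_sets \<Longrightarrow> is_cob1 (id_cob1 m)"
  by (rule balanced_is_cob1)
    (auto simp: cospan_def balanced_def id_cob1_def in_ends_def out_ends_def points_def
      finite_signed_sets_def inj_on_def image_Un image_image)

lemma category_one_Cob: "category (one_Cob :: ('a signed_set, ('a, nat) cob1 set) cat)"
proof
  let ?C = "one_Cob :: ('a signed_set, ('a, nat) cob1 set) cat"
  show "X \<in> Ob ?C \<and> Y \<in> Ob ?C" if "f \<in> Hom ?C X Y" for f X Y
    using that by (auto elim!: Hom_one_CobE simp: is_cob1_def)
  show "X = X' \<and> Y = Y'" if "f \<in> Hom ?C X Y" "f \<in> Hom ?C X' Y'" for f X Y X' Y'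
    using that by (metis Hom_one_CobE class1_Hom_unique)
  show "Id ?C X \<in> Hom ?C X X" if "X \<in> Ob ?C" for X
    using class1_Hom[OF id_cob1_is_cob1, of X X X] that by (simp add: id_cob1_def)
  show "cmp ?C g f \<in> Hom ?C X Z" if f: "f \<in> Hom ?C X Y" and g: "g \<in> Hom ?C Y Z" for f g X Y Z
  proof -
    obtain K :: "('a, nat) cob1" where K: "f = class1 K" "is_cob1 K" "src1 K = X" "tgt1 K = Y"
      using f by (rule Hom_one_CobE)
    obtain L :: "('a, nat) cob1" where L: "g = class1 L" "is_cob1 L" "src1 L = Y" "tgt1 L = Z"
      using g by (rule Hom_one_CobE)
    obtain i j where comp: "composite K L (compose1 L K) i j"
      using composite_compose1[of K L] K L by auto
    show ?thesis
      using cmp_class1[OF comp K(2) L(2)] composite_is_cob1[OF comp K(2) L(2)] compositeD(2,3)[OF comp] K L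
      by (simp add: class1_Hom)
  qed
  show "cmp ?C (Id ?C Y) f = f" "cmp ?C f (Id ?C X) = f" if f: "f \<in> Hom ?C X Y" for f X Y
  proof -
    obtain K :: "('a, nat) cob1" where K: "f = class1 K" "is_cob1 K" "src1 K = X" "tgt1 K = Y"
      using f by (rule Hom_one_CobE)
    then have ob: "X \<in> finite_signed_sets" "Y \<in> finite_signed_sets"
      by (auto simp: is_cob1_def)
    show "cmp ?C (Id ?C Y) f = f"
      using cmp_class1[OF composite_id_right[OF is_cob1_cospan[OF K(2)] K(4)] K(2) id_cob1_is_cob1[OF ob(2)]]
      by (simp add: K(1))
    show "cmp ?C f (Id ?C X) = f"
      using cmp_class1[OF composite_id_left[OF is_cob1_cospan[OF K(2)] K(3)] id_cob1_is_cob1[OF ob(1)] K(2)]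
      by (simp add: K(1))
  qed
  show "cmp ?C h (cmp ?C g f) = cmp ?C (cmp ?C h g) f"
    if f: "f \<in> Hom ?C W X" and g: "g \<in> Hom ?C X Y" and h: "h \<in> Hom ?C Y Z" for f g h W X Y Z
  proof -
    obtain K :: "('a, nat) cob1" where K: "f = class1 K" "is_cob1 K" "src1 K = W" "tgt1 K = X"
      using f by (rule Hom_one_CobE)
    obtain L :: "('a, nat) cob1" where L: "g = class1 L" "is_cob1 L" "src1 L = X" "tgt1 L = Y"
      using g by (rule Hom_one_CobE)
    obtain M :: "('a, nat) cob1" where M: "h = class1 M" "is_cob1 M" "src1 M = Y" "tgt1 M = Z"
      using h by (rule Hom_one_CobE)
    obtain i j where P: "composite K L (compose1 L K) i j"
      using composite_compose1[of K L] K L by auto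
    obtain k l where R: "composite L M (compose1 M L) k l"
      using composite_compose1[of L M] L M by auto
    obtain i' j' where Q: "composite (compose1 L K) M (compose1 M (compose1 L K)) i' j'"
      using composite_compose1[of "compose1 L K" M] compositeD(3)[OF P] L M by auto
    obtain k' l' where T: "composite K (compose1 M L) (compose1 (compose1 M L) K) k' l'"
      using composite_compose1[of K "compose1 M L"] compositeD(2)[OF R] K L by auto
    note cobs = composite_is_cob1[OF P K(2) L(2)] composite_is_cob1[OF R L(2) M(2)]
    note cobs' = composite_is_cob1[OF Q cobs(1) M(2)] composite_is_cob1[OF T K(2) cobs(2)]
    have "equiv1 (compose1 M (compose1 L K)) (compose1 (compose1 M L) K)"
      using composite_assoc[OF P Q R T] K(2) L(2) M(2) by (simp add: is_cob1_cospan)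
    then have "class1 (compose1 M (compose1 L K)) = class1 (compose1 (compose1 M L) K)"
      using class1_eq_iff cobs' by blast
    then show ?thesis
      using cmp_class1[OF P K(2) L(2)] cmp_class1[OF R L(2) M(2)] cmp_class1[OF Q cobs(1) M(2)]
        cmp_class1[OF T K(2) cobs(2)] by (simp add: K(1) L(1) M(1))
  qed
qed


section \<open>Cofibrations and fibrations\<close>

text \<open>The two classes, expressed for presentations. The map \<open>u\<close> required of a cofibration exists if and only if
  every component that meets the target meets the source.\<close>

definition cofib :: "('a, 'c) cob1 \<Rightarrow> bool" where
  "cofib K \<longleftrightarrow> inj_on (ltgt1 K) (points (tgt1 K)) \<and>
     ltgt1 K ` points (tgt1 K) \<subseteq> lsrc1 K ` points (src1 K)"

definition fib :: "('a, 'c) cob1 \<Rightarrow> bool" where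
  "fib K \<longleftrightarrow> inj_on (lsrc1 K) (points (src1 K)) \<and> ltgt1 K ` points (tgt1 K) = comps1 K"

lemma finite_points: "m \<in> finite_signed_sets \<Longrightarrow> finite (points m)"
  by (simp add: finite_signed_sets_def points_def)

lemma equiv2_trans:
  assumes "equiv2 A B" "equiv2 B D"
  shows "equiv2 A D"
proof -
  obtain h where h: "bij_betw h (comps2 A) (comps2 B)" "\<forall>a\<in>src2 A. h (lsrc2 A a) = lsrc2 B a"
      "\<forall>a\<in>tgt2 A. h (ltgt2 A a) = ltgt2 B a" "\<forall>c\<in>comps2 A. genus2 B (h c) = genus2 A c"
      "src2 A = src2 B" "tgt2 A = tgt2 B"
    using \<open>equiv2 A B\<close> unfolding equiv2_def by blast
  obtain k where k: "bij_betw k (comps2 B) (comps2 D)" "\<forall>a\<in>src2 B. k (lsrc2 B a) = lsrc2 D a"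
      "\<forall>a\<in>tgt2 B. k (ltgt2 B a) = ltgt2 D a" "\<forall>c\<in>comps2 B. genus2 D (k c) = genus2 B c"
      "src2 B = src2 D" "tgt2 B = tgt2 D"
    using \<open>equiv2 B D\<close> unfolding equiv2_def by blast
  show ?thesis
    unfolding equiv2_def
    by (intro conjI exI[of _ "k \<circ> h"]) (use h k bij_betwE[OF h(1)] in \<open>auto simp: bij_betw_trans\<close>)
qed

lemma Phi_class1:
  fixes K :: "('a, nat) cob1"
  assumes K: "is_cob1 K"
  shows "Phi (class1 K) = class2 (forget_signs K)"
proof -
  have "class2 (forget_signs K') = class2 (forget_signs K)" if "K' \<in> class1 K" for K'
  proof -
    have "equiv1 K K'"
      using that by (simp add: class1_def)
    moreover from this have "equiv1 K' K"
      by (rule equiv1_sym[OF K])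
    ultimately have KK: "equiv2 (forget_signs K) (forget_signs K')" "equiv2 (forget_signs K') (forget_signs K)"
      unfolding equiv1_def equiv2_def forget_signs_def by auto
    have "equiv2 (forget_signs K') Q \<longleftrightarrow> equiv2 (forget_signs K) Q" for Q :: "('a, nat) cob2"
      using equiv2_trans[OF KK(1)] equiv2_trans[OF KK(2)] by blast
    then show ?thesis
      by (simp add: class2_def)
  qed
  moreover have "K \<in> class1 K"
    by (simp add: class1_def equiv1_refl)
  ultimately show ?thesis
    unfolding Phi_def by blast
qed

lemma Phi_class1_Arr:
  fixes K :: "('a, nat) cob1"
  assumes K: "is_cob1 K"
  shows "Phi (class1 K) \<in> Arr two_Cob"
proof -
  have "is_cob2 (forget_signs K)"
    using K finite_points unfolding is_cob1_def is_cob2_def forget_signs_def by auto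
  moreover from this have "finite (src2 (forget_signs K))" "finite (tgt2 (forget_signs K))"
    by (simp_all add: is_cob2_def)
  ultimately show ?thesis
    unfolding Phi_class1[OF K] Arr_def two_Cob_def by auto
qed

lemma in_class2_forget_signs:
  assumes "K' \<in> class2 (forget_signs K)"
  obtains h where "bij_betw h (comps1 K) (comps2 K')"
    and "\<forall>a\<in>points (src1 K). lsrc2 K' a = h (lsrc1 K a)" and "\<forall>b\<in>points (tgt1 K). ltgt2 K' b = h (ltgt1 K b)"
    and "\<forall>c\<in>comps1 K. genus2 K' (h c) = 0" and "src2 K' = points (src1 K)" and "tgt2 K' = points (tgt1 K)"
proof -
  have "equiv2 (forget_signs K) K'"
    using assms by (simp add: class2_def)
  then obtain h where h: "bij_betw h (comps1 K) (comps2 K')"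
      "\<forall>a\<in>points (src1 K). h (lsrc1 K a) = lsrc2 K' a" "\<forall>b\<in>points (tgt1 K). h (ltgt1 K b) = ltgt2 K' b"
      "\<forall>c\<in>comps1 K. genus2 K' (h c) = 0" "points (src1 K) = src2 K'" "points (tgt1 K) = tgt2 K'"
    unfolding equiv2_def forget_signs_def by simp blast
  then show thesis
    by (intro that[of h]) simp_all
qed

lemma forget_signs_in_class2: "forget_signs K \<in> class2 (forget_signs K)"
  unfolding class2_def equiv2_def by (auto intro!: exI[of _ "\<lambda>x. x"] simp: bij_betw_def)

text \<open>The class \<open>Phi (class1 K)\<close> contains all presentations by natural numbers that are isomorphic to
  \<open>forget_signs K\<close>, so that the conditions have to be moved along an isomorphism.\<close>

lemma cofibrations1_iff:
  fixes K :: "('a, nat) cob1"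
  assumes K: "is_cob1 K"
  shows "class1 K \<in> cofibrations1 \<longleftrightarrow> cofib K"
proof -
  note labels = is_cob1_labels[OF K]
  have arr: "class1 K \<in> Arr one_Cob"
    using class1_Hom[OF K refl refl] K unfolding Arr_def by (auto simp: is_cob1_def)
  have "Phi (class1 K) \<in> cofibrations2 \<longleftrightarrow> (\<exists>K'\<in>class2 (forget_signs K).
      inj_on (ltgt2 K') (tgt2 K') \<and> ltgt2 K' ` tgt2 K' \<subseteq> lsrc2 K' ` src2 K')"
  proof -
    have "(\<exists>u. u ` tgt2 K' \<subseteq> src2 K' \<and> (\<forall>a\<in>tgt2 K'. ltgt2 K' a = lsrc2 K' (u a))) \<longleftrightarrow>
        ltgt2 K' ` tgt2 K' \<subseteq> lsrc2 K' ` src2 K'" for K' :: "('a, nat) cob2"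
    proof
      assume "ltgt2 K' ` tgt2 K' \<subseteq> lsrc2 K' ` src2 K'"
      then have "\<forall>a\<in>tgt2 K'. \<exists>b. b \<in> src2 K' \<and> ltgt2 K' a = lsrc2 K' b"
        by blast
      then show "\<exists>u. u ` tgt2 K' \<subseteq> src2 K' \<and> (\<forall>a\<in>tgt2 K'. ltgt2 K' a = lsrc2 K' (u a))"
        by (metis image_subsetI)
    qed auto
    then show ?thesis
      using Phi_class1_Arr[OF K] unfolding cofibrations2_def Phi_class1[OF K] by simp
  qed
  also have "\<dots> \<longleftrightarrow> (\<exists>K'\<in>class2 (forget_signs K). cofib K)"
  proof (rule bex_cong[OF refl])
    fix K' assume "K' \<in> class2 (forget_signs K)"
    then obtain h where h: "bij_betw h (comps1 K) (comps2 K')"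
        "\<forall>a\<in>points (src1 K). lsrc2 K' a = h (lsrc1 K a)" "\<forall>b\<in>points (tgt1 K). ltgt2 K' b = h (ltgt1 K b)"
        "src2 K' = points (src1 K)" "tgt2 K' = points (tgt1 K)"
      by (rule in_class2_forget_signs) blast
    have inj: "h c = h d \<longleftrightarrow> c = d" if "c \<in> comps1 K" "d \<in> comps1 K" for c d
      using h(1) that by (meson bij_betw_def inj_on_eq_iff)
    have "inj_on (ltgt2 K') (tgt2 K') \<longleftrightarrow> inj_on (ltgt1 K) (points (tgt1 K))"
      unfolding inj_on_def h(5) using h(3) inj labels(2) by simp
    moreover have "ltgt2 K' ` tgt2 K' \<subseteq> lsrc2 K' ` src2 K' \<longleftrightarrow>
        (\<forall>b\<in>points (tgt1 K). \<exists>a\<in>points (src1 K). ltgt1 K b = lsrc1 K a)"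
      unfolding h(4,5) image_subset_iff image_iff using h(2,3) inj labels(1,2) by simp
    ultimately show "inj_on (ltgt2 K') (tgt2 K') \<and> ltgt2 K' ` tgt2 K' \<subseteq> lsrc2 K' ` src2 K' \<longleftrightarrow> cofib K"
      unfolding cofib_def image_subset_iff image_iff by simp
  qed
  also have "\<dots> \<longleftrightarrow> cofib K"
    using forget_signs_in_class2[of K] by blast
  finally show ?thesis
    using arr unfolding cofibrations1_def by simp
qed

lemma fibrations1_iff:
  fixes K :: "('a, nat) cob1"
  assumes K: "is_cob1 K"
  shows "class1 K \<in> fibrations1 \<longleftrightarrow> fib K"
proof -
  note labels = is_cob1_labels[OF K]
  have arr: "class1 K \<in> Arr one_Cob"
    using class1_Hom[OF K refl refl] K unfolding Arr_def by (auto simp: is_cob1_def)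
  have "Phi (class1 K) \<in> fibrations2 \<longleftrightarrow> (\<exists>K'\<in>class2 (forget_signs K).
      inj_on (lsrc2 K') (src2 K') \<and> ltgt2 K' ` tgt2 K' = comps2 K' \<and> (\<forall>a\<in>src2 K'. genus2 K' (lsrc2 K' a) = 0))"
    using Phi_class1_Arr[OF K] unfolding fibrations2_def Phi_class1[OF K] by simp
  also have "\<dots> \<longleftrightarrow> (\<exists>K'\<in>class2 (forget_signs K). fib K)"
  proof (rule bex_cong[OF refl])
    fix K' assume "K' \<in> class2 (forget_signs K)"
    then obtain h where h: "bij_betw h (comps1 K) (comps2 K')"
        "\<forall>a\<in>points (src1 K). lsrc2 K' a = h (lsrc1 K a)" "\<forall>b\<in>points (tgt1 K). ltgt2 K' b = h (ltgt1 K b)"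
        "src2 K' = points (src1 K)" "tgt2 K' = points (tgt1 K)" "\<forall>c\<in>comps1 K. genus2 K' (h c) = 0"
      by (rule in_class2_forget_signs) blast
    have inj: "h c = h d \<longleftrightarrow> c = d" if "c \<in> comps1 K" "d \<in> comps1 K" for c d
      using h(1) that by (meson bij_betw_def inj_on_eq_iff)
    have "inj_on (lsrc2 K') (src2 K') \<longleftrightarrow> inj_on (lsrc1 K) (points (src1 K))"
      unfolding inj_on_def h(4) using h(2) inj labels(1) by simp
    moreover have "ltgt2 K' ` tgt2 K' = comps2 K' \<longleftrightarrow> ltgt1 K ` points (tgt1 K) = comps1 K"
    proof -
      have "ltgt2 K' ` tgt2 K' = h ` ltgt1 K ` points (tgt1 K)"
        unfolding h(5) image_image using h(3) by simp
      moreover have "comps2 K' = h ` comps1 K"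
        using h(1) by (simp add: bij_betw_def)
      moreover have "ltgt1 K ` points (tgt1 K) \<subseteq> comps1 K"
        using labels(2) by blast
      ultimately show ?thesis
        using inj_on_image_eq_iff[OF bij_betw_imp_inj_on[OF h(1)], of "ltgt1 K ` points (tgt1 K)" "comps1 K"]
        by simp
    qed
    moreover have "\<forall>a\<in>src2 K'. genus2 K' (lsrc2 K' a) = 0"
      unfolding h(4) using h(2,6) labels(1) by simp
    ultimately show "inj_on (lsrc2 K') (src2 K') \<and> ltgt2 K' ` tgt2 K' = comps2 K' \<and>
        (\<forall>a\<in>src2 K'. genus2 K' (lsrc2 K' a) = 0) \<longleftrightarrow> fib K"
      unfolding fib_def by simp
  qed
  also have "\<dots> \<longleftrightarrow> fib K"
    using forget_signs_in_class2[of K] by blast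
  finally show ?thesis
    using arr unfolding fibrations1_def by simp
qed

text \<open>Follow a point of the target of \<open>L\<close> back to the middle and from there to the source of \<open>K\<close>.\<close>

lemma cofib_composite:
  assumes comp: "composite K L P i j" and K: "cofib K" and L: "cofib L" and cospans: "cospan K" "cospan L"
  shows "cofib P"
proof -
  note D = compositeD[OF comp]
  have "inj_on j (comps1 L)"
    using pushout_square_inj[OF D(4)] K D(1) by (simp add: cofib_def)
  moreover have "inj_on (ltgt1 L) (points (tgt1 L))"
    using L by (simp add: cofib_def)
  ultimately have "inj_on (ltgt1 P) (points (tgt1 P))"
    using D(3,6) cospan_labels(2)[OF cospans(2)] by (auto simp: inj_on_def)
  moreover have "ltgt1 P b \<in> lsrc1 P ` points (src1 P)" if "b \<in> points (tgt1 P)" for b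
  proof -
    have "ltgt1 L b \<in> lsrc1 L ` points (src1 L)"
      using L that D(3) unfolding cofib_def by auto
    then obtain y where y: "y \<in> points (src1 L)" "ltgt1 L b = lsrc1 L y"
      by blast
    have "ltgt1 K y \<in> lsrc1 K ` points (src1 K)"
      using K y(1) D(1) unfolding cofib_def by auto
    then obtain a where a: "a \<in> points (src1 K)" "ltgt1 K y = lsrc1 K a"
      by blast
    have "ltgt1 P b = j (lsrc1 L y)"
      using D(6) that D(3) y by simp
    also have "\<dots> = i (lsrc1 K a)"
      using pushout_square_commutes[OF D(4) y(1)] a(2) by simp
    also have "\<dots> = lsrc1 P a"
      using D(5) a(1) by simp
    finally show ?thesis
      using a(1) D(2) by simp
  qed
  ultimately show ?thesis
    unfolding cofib_def by blast
qed

text \<open>Every component of \<open>K\<close> meets the middle, so it becomes part of a component of \<open>L\<close>, which meets the target.\<close>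

lemma fib_composite:
  assumes comp: "composite K L P i j" and K: "fib K" and L: "fib L" and cospans: "cospan K" "cospan L"
  shows "fib P"
proof -
  note D = compositeD[OF comp]
  have "inj_on i (comps1 K)"
    using pushout_square_inj[OF pushout_square_sym[OF D(4)]] L by (simp add: fib_def)
  moreover have "inj_on (lsrc1 K) (points (src1 K))"
    using K by (simp add: fib_def)
  ultimately have "inj_on (lsrc1 P) (points (src1 P))"
    using D(2,5) cospan_labels(1)[OF cospans(1)] by (auto simp: inj_on_def)
  moreover have "ltgt1 P ` points (tgt1 P) = comps1 P"
  proof -
    have "ltgt1 P ` points (tgt1 P) = j ` ltgt1 L ` points (tgt1 L)"
      using D(3,6) by (simp add: image_image)
    then have "ltgt1 P ` points (tgt1 P) = j ` comps1 L"
      using L by (simp add: fib_def)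
    moreover have "i ` comps1 K \<subseteq> j ` comps1 L"
    proof -
      have "comps1 K = ltgt1 K ` points (src1 L)"
        using K D(1) by (simp add: fib_def)
      then show ?thesis
        using pushout_square_commutes[OF D(4)] cospan_labels(1)[OF cospans(2)] by auto
    qed
    ultimately show ?thesis
      using pushout_square_cover[OF D(4)] by (simp add: Un_absorb1)
  qed
  ultimately show ?thesis
    unfolding fib_def by blast
qed

lemma composite_id_cob1_imp_inj:
  assumes comp: "composite K L (id_cob1 m) i j"
  shows "inj_on (lsrc1 K) (points (src1 K))" and "inj_on (ltgt1 L) (points (tgt1 L))"
proof -
  note D = compositeD[OF comp]
  have "i (lsrc1 K a) = a" if "a \<in> points (src1 K)" for a
    using D(5)[OF that] by (simp add: id_cob1_def)
  then show "inj_on (lsrc1 K) (points (src1 K))"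
    by (metis inj_onI)
  have "j (ltgt1 L b) = b" if "b \<in> points (tgt1 L)" for b
    using D(6)[OF that] by (simp add: id_cob1_def)
  then show "inj_on (ltgt1 L) (points (tgt1 L))"
    by (metis inj_onI)
qed

text \<open>A component of \<open>K\<close> that does not meet the middle would survive in the composite as a component that does not
  meet the target, and the identity has no such component. For \<open>L\<close> the same holds with source and target
  exchanged.\<close>

lemma composite_id_cob1_imp_surj:
  assumes comp: "composite K L (id_cob1 m) i j" and cospans: "cospan K" "cospan L"
  shows "ltgt1 K ` points (tgt1 K) = comps1 K" and "lsrc1 L ` points (src1 L) = comps1 L"
proof -
  note D = compositeD[OF comp]
  have m: "src1 K = m" "tgt1 L = m" "comps1 (id_cob1 m) = points m"
    using D(2,3) by (simp_all add: id_cob1_def)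
  have ij: "i (lsrc1 K a) = a" "j (ltgt1 L a) = a" if "a \<in> points m" for a
    using D(5)[of a] D(6)[of a] that m by (simp_all add: id_cob1_def)
  have cover: "points m = i ` comps1 K \<union> j ` comps1 L"
    using pushout_square_cover[OF D(4)] m(3) by simp
  have "c \<in> ltgt1 K ` points (src1 L)" if c: "c \<in> comps1 K" for c
  proof (rule ccontr)
    assume "c \<notin> ltgt1 K ` points (src1 L)"
    then have "i c \<notin> j ` comps1 L"
      by (rule pushout_square_unglued(1)[OF D(4) c])
    moreover have "i c \<in> points m"
      using cover c by blast
    moreover have "j (ltgt1 L (i c)) \<in> j ` comps1 L"
      using cospan_labels(2)[OF cospans(2)] m \<open>i c \<in> points m\<close> by simp
    ultimately show False
      using ij(2)[of "i c"] by simp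
  qed
  then show "ltgt1 K ` points (tgt1 K) = comps1 K"
    using cospan_labels(2)[OF cospans(1)] D(1) by auto
  have "c \<in> lsrc1 L ` points (src1 L)" if c: "c \<in> comps1 L" for c
  proof (rule ccontr)
    assume "c \<notin> lsrc1 L ` points (src1 L)"
    then have "j c \<notin> i ` comps1 K"
      by (rule pushout_square_unglued(1)[OF pushout_square_sym[OF D(4)] c])
    moreover have "j c \<in> points m"
      using cover c by blast
    moreover have "i (lsrc1 K (j c)) \<in> i ` comps1 K"
      using cospan_labels(1)[OF cospans(1)] m \<open>j c \<in> points m\<close> by simp
    ultimately show False
      using ij(1)[of "j c"] by simp
  qed
  then show "lsrc1 L ` points (src1 L) = comps1 L"
    using cospan_labels(1)[OF cospans(2)] by auto
qed

text \<open>In one composite \<open>K\<close> comes first and in the other second, and together they say that both structure maps of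
  \<open>K\<close> are bijections onto its components.\<close>

lemma invertible_cofib_fib:
  assumes KL: "composite K L (id_cob1 m) i j" and LK: "composite L K (id_cob1 n) i' j'"
    and cospans: "cospan K" "cospan L"
  shows "cofib K" and "fib K"
  using composite_id_cob1_imp_inj[OF KL] composite_id_cob1_imp_inj[OF LK]
    composite_id_cob1_imp_surj[OF KL cospans] composite_id_cob1_imp_surj[OF LK cospans(2,1)]
  by (simp_all add: cofib_def fib_def)


section \<open>Factorization\<close>

text \<open>The middle object \<open>Z\<close> consists of the points of the source that are connected to the target; it is a set of
  points of the source in order to stay within the given type of points. Both factors are unions of
  components of \<open>K\<close> that have exactly the strands between source and target in common.\<close>

lemma factorization_cob1:
  fixes K :: "('a, 'c) cob1"
  assumes K: "is_cob1 K"
  shows "\<exists>(E :: ('a, 'c) cob1) (R :: ('a, 'c) cob1) i j. is_cob1 E \<and> is_cob1 R \<and> cofib E \<and> fib R \<and>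
    composite E R K i j"
proof -
  let ?p = "lsrc1 K ` pos (src1 K)" and ?n = "lsrc1 K ` neg (src1 K)"
  let ?p' = "ltgt1 K ` pos (tgt1 K)" and ?n' = "ltgt1 K ` neg (tgt1 K)"
  define X where "X = points (src1 K)"
  define Y where "Y = points (tgt1 K)"
  define Z where "Z = Signed {a \<in> neg (src1 K). lsrc1 K a \<in> ltgt1 K ` Y} {a \<in> pos (src1 K). lsrc1 K a \<in> ltgt1 K ` Y}"
  define E where "E = \<lparr>src1 = src1 K, tgt1 = Z, comps1 = comps1 K - (ltgt1 K ` Y - lsrc1 K ` X),
    lsrc1 = lsrc1 K, ltgt1 = lsrc1 K\<rparr>"
  define R where "R = \<lparr>src1 = Z, tgt1 = tgt1 K, comps1 = ltgt1 K ` Y, lsrc1 = lsrc1 K, ltgt1 = ltgt1 K\<rparr>"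
  have bal: "inj_on (lsrc1 K) (pos (src1 K))" "inj_on (lsrc1 K) (neg (src1 K))"
      "inj_on (ltgt1 K) (pos (tgt1 K))" "inj_on (ltgt1 K) (neg (tgt1 K))"
      "?p \<inter> ?n' = {}" "?n \<inter> ?p' = {}" "?p \<union> ?n' = ?n \<union> ?p'"
    using is_cob1_balanced[OF K] unfolding balanced_iff by blast+
  have imY: "ltgt1 K ` Y = ?p' \<union> ?n'"
    unfolding Y_def points_def by (auto simp: image_Un)
  have Zpos: "lsrc1 K ` pos Z = ?p \<inter> ?p'" and Zneg: "lsrc1 K ` neg Z = ?n \<inter> ?n'"
    unfolding Z_def imY using bal(5,6) by auto
  have pZ: "points Z = {a \<in> X. lsrc1 K a \<in> ltgt1 K ` Y}"
    unfolding Z_def X_def points_def by auto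
  have sub: "pos Z \<subseteq> pos (src1 K)" "neg Z \<subseteq> neg (src1 K)"
    unfolding Z_def by auto
  have K': "src1 K \<in> finite_signed_sets" "tgt1 K \<in> finite_signed_sets" "finite (comps1 K)"
      "lsrc1 K ` X \<subseteq> comps1 K" "ltgt1 K ` Y \<subseteq> comps1 K"
    using K by (simp_all add: is_cob1_def X_def Y_def)
  have Z: "Z \<in> finite_signed_sets"
    using K'(1) unfolding Z_def finite_signed_sets_def by auto
  have injZ: "inj_on (lsrc1 K) (pos Z)" "inj_on (lsrc1 K) (neg Z)"
    using bal(1,2) sub by (auto intro: inj_on_subset)
  have sets: "A \<inter> (B \<inter> B') = {}" "B \<inter> (A \<inter> A') = {}" "A \<union> B \<inter> B' = B \<union> A \<inter> A'"
      "A \<inter> A' \<inter> B' = {}" "B \<inter> B' \<inter> A' = {}" "A \<inter> A' \<union> B' = B \<inter> B' \<union> A'"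
    if "A \<inter> B' = {}" "B \<inter> A' = {}" "A \<union> B' = B \<union> A'" for A A' B B' :: "'c set"
    using that by auto
  have "is_cob1 E"
  proof (rule balanced_is_cob1)
    show "cospan E"
      unfolding cospan_def using K' Z pZ by (auto simp: E_def X_def[symmetric])
    show "balanced E"
      unfolding balanced_iff using bal(1,2) injZ sets(1-3)[OF bal(5-7)] by (simp add: E_def Zpos Zneg)
  qed
  moreover have "is_cob1 R"
  proof (rule balanced_is_cob1)
    show "cospan R"
      unfolding cospan_def using K' Z pZ by (auto simp: R_def Y_def[symmetric] intro: finite_subset)
    show "balanced R"
      unfolding balanced_iff using bal(3,4) injZ sets(4-6)[OF bal(5-7)] by (simp add: R_def Zpos Zneg)
  qed
  moreover have inj: "inj_on (lsrc1 K) (points Z)"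
  proof -
    have "lsrc1 K ` neg Z \<inter> lsrc1 K ` pos Z = {}"
      unfolding Zpos Zneg using bal(5) by blast
    then have "lsrc1 K ` (neg Z - pos Z) \<inter> lsrc1 K ` (pos Z - neg Z) = {}"
      by blast
    then show ?thesis
      unfolding points_def inj_on_Un using injZ by blast
  qed
  moreover have "cofib E"
    unfolding cofib_def using inj pZ by (auto simp: E_def X_def)
  moreover have "fib R"
    unfolding fib_def using inj by (simp add: R_def Y_def)
  moreover have "composite E R K (\<lambda>c. c) (\<lambda>c. c)"
  proof -
    have "pushout_square (comps1 E) (comps1 R) (points Z) (lsrc1 K) (lsrc1 K) (comps1 K) (\<lambda>c. c) (\<lambda>c. c)"
      unfolding pushout_square_def
    proof (intro conjI allI impI ballI)
      show "comps1 K = (\<lambda>c. c) ` comps1 E \<union> (\<lambda>c. c) ` comps1 R"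
        using K'(5) by (auto simp: E_def R_def)
      fix U V assume UV: "\<forall>y\<in>points Z. lsrc1 K y \<in> U \<longleftrightarrow> lsrc1 K y \<in> V"
      have "c \<in> U \<longleftrightarrow> c \<in> V" if c: "c \<in> comps1 E" "c \<in> comps1 R" for c
      proof -
        obtain a where a: "a \<in> X" "c = lsrc1 K a"
          using c by (auto simp: E_def R_def)
        then have "a \<in> points Z"
          using c(2) pZ by (simp add: R_def)
        with a(2) show ?thesis
          using UV by blast
      qed
      then show "\<exists>W. (\<forall>a\<in>comps1 E. a \<in> W \<longleftrightarrow> a \<in> U) \<and> (\<forall>b\<in>comps1 R. b \<in> W \<longleftrightarrow> b \<in> V)"
        by (intro exI[of _ "U \<inter> comps1 E \<union> V \<inter> comps1 R"]) blast
    qed simp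
    then show ?thesis
      unfolding composite_def by (simp add: E_def R_def)
  qed
  ultimately show ?thesis
    by blast
qed


section \<open>Orthogonality\<close>

text \<open>Cofibrations are epimorphisms. As the components of \<open>W\<close> are a subset of those of the composite \<open>U\<close>, and every
  boundary point of \<open>W\<close> can be traced to one of \<open>U\<close>, the composite knows which boundary points of \<open>W\<close> are
  connected. Loops of \<open>W\<close> and of \<open>K\<close> cannot be told apart in \<open>U\<close>, but they can be counted.\<close>

lemma cofib_cancel:
  assumes comp: "composite K W U i j" and comp': "composite K W' U i' j'" and K: "cofib K"
    and cospans: "cospan K" "cospan W" "cospan W'"
  shows "equiv1 W W'"
proof -
  note D = compositeD[OF comp] and D' = compositeD[OF comp']
  have st: "src1 W' = src1 W" "tgt1 W' = tgt1 W"
    using D(1,3) D'(1,3) by simp_all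
  have inj: "inj_on (ltgt1 K) (points (src1 W))"
    using K D(1) by (simp add: cofib_def)
  have injs: "inj_on j (comps1 W)" "inj_on j' (comps1 W')"
    using pushout_square_inj[OF D(4)] pushout_square_inj[OF D'(4)] inj st by simp_all
  let ?S = "points (src1 W) <+> points (tgt1 W)"
  have mem: "label W x \<in> comps1 W" "label W' x \<in> comps1 W'" if "x \<in> ?S" for x
    using that cospan_labels(1,2)[OF cospans(2)] cospan_labels(1,2)[OF cospans(3)] st by auto
  have same: "j (label W x) = j' (label W' x)" if "x \<in> ?S" for x
    using that
  proof (elim PlusE)
    fix y assume y: "x = Inl y" "y \<in> points (src1 W)"
    have "ltgt1 K y \<in> lsrc1 K ` points (src1 K)"
      using K y(2) D(1) by (auto simp: cofib_def)
    then obtain a where a: "a \<in> points (src1 K)" "ltgt1 K y = lsrc1 K a"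
      by blast
    have "j (lsrc1 W y) = i (lsrc1 K a)"
      using pushout_square_commutes[OF D(4) y(2)] a(2) by simp
    also have "\<dots> = i' (lsrc1 K a)"
      using D(5)[OF a(1)] D'(5)[OF a(1)] by simp
    also have "\<dots> = j' (lsrc1 W' y)"
      using pushout_square_commutes[OF D'(4), of y] y(2) a(2) st by simp
    finally show ?thesis
      using y(1) by simp
  next
    fix z assume "x = Inr z" "z \<in> points (tgt1 W)"
    then show ?thesis
      using D(6)[of z] D'(6)[of z] st by simp
  qed
  have ker: "label W x = label W y \<longleftrightarrow> label W' x = label W' y" if "x \<in> ?S" "y \<in> ?S" for x y
    using same[OF that(1)] same[OF that(2)] mem[OF that(1)] mem[OF that(2)]
      inj_on_eq_iff[OF injs(1), of "label W x" "label W y"]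
      inj_on_eq_iff[OF injs(2), of "label W' x" "label W' y"] by metis
  have card: "card (comps1 W) = card (comps1 W')"
    using pushout_square_card[OF D(4) inj] pushout_square_card[OF D'(4)[unfolded st] inj]
      cospan_labels[OF cospans(1)] cospan_labels[OF cospans(2)] cospan_labels[OF cospans(3)] st
    by (simp add: image_subset_iff)
  obtain h where h: "bij_betw h (comps1 W) (comps1 W')" "\<And>x. x \<in> ?S \<Longrightarrow> h (label W x) = label W' x"
  proof (rule bij_betw_extending_same_kernel[OF ker _ _ card])
    show "finite (comps1 W)" "finite (comps1 W')"
      using cospan_labels(3) cospans by blast+
    show "label W ` ?S \<subseteq> comps1 W" "label W' ` ?S \<subseteq> comps1 W'"
      using mem by blast+
  qed blast+
  show ?thesis
    by (rule equiv1I[OF st(1)[symmetric] st(2)[symmetric] h(1)]) (use h(2)[OF InlI] h(2)[OF InrI] in simp_all)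
qed

text \<open>The lift has as components the components of \<open>P\<close> that come from \<open>U\<close> as well as from \<open>V\<close>. Its incoming
  and outgoing ends on the side of \<open>V\<close> correspond along the strands of \<open>K\<close> to ends of \<open>U\<close>, with the same sign.\<close>

lemma lifting_cob1:
  fixes P :: "('a, 'p) cob1"
  assumes KV: "composite K V P i j" and UR: "composite U R P i' j'" and K: "cofib K" and R: "fib R"
    and cobs: "is_cob1 K" "is_cob1 V" "is_cob1 U" "is_cob1 R"
  shows "\<exists>(W :: ('a, 'p) cob1) k l k' l'. is_cob1 W \<and> composite K W U k l \<and> composite W R V k' l'"
proof -
  note D = compositeD[OF KV] and D' = compositeD[OF UR]
  note cospans = cobs[THEN is_cob1_cospan]
  have inj: "inj_on j (comps1 V)" "inj_on i' (comps1 U)"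
    using pushout_square_inj[OF D(4)] pushout_square_inj[OF pushout_square_sym[OF D'(4)]] K R D(1)
    by (simp_all add: cofib_def fib_def)
  have st: "src1 U = src1 K" "tgt1 K = src1 V" "tgt1 U = src1 R" "tgt1 R = tgt1 V"
    using D(1-3) D'(1-3) by simp_all
  let ?IU = "i' ` comps1 U" and ?JV = "j ` comps1 V"
  define W where "W = \<lparr>src1 = src1 V, tgt1 = tgt1 U, comps1 = ?IU \<inter> ?JV,
    lsrc1 = j \<circ> lsrc1 V, ltgt1 = i' \<circ> ltgt1 U\<rparr>"
  (* Every component of a fibration meets the target. *)
  have JR: "j' ` comps1 R \<subseteq> ?JV"
  proof -
    have "j' (ltgt1 R b) = j (ltgt1 V b)" if "b \<in> points (tgt1 R)" for b
      using D'(6)[OF that] D(6)[of b] that st(4) by simp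
    moreover have "comps1 R = ltgt1 R ` points (tgt1 R)"
      using R by (simp add: fib_def)
    ultimately show ?thesis
      using cospan_labels(2)[OF cospans(2)] st(4) by auto
  qed
  have common: "i (lsrc1 K a) = i' (lsrc1 U a)" if "a \<in> points (src1 K)" for a
    using D(5)[OF that] D'(5)[of a] that st(1) by simp
  (* A strand of K is continued by U. A cap or a loop of K is not in V, so it is in U. *)
  have IK: "i ` comps1 K \<subseteq> ?IU"
  proof
    fix p assume "p \<in> i ` comps1 K"
    then obtain c where c: "c \<in> comps1 K" "p = i c"
      by blast
    show "p \<in> ?IU"
    proof (cases "c \<in> ltgt1 K ` points (src1 V)")
      case True
      then have "c \<in> lsrc1 K ` points (src1 K)"
        using K st(2) by (auto simp: cofib_def)
      then show ?thesis
        using common c(2) cospan_labels(1)[OF cospans(3)] st(1) by auto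
    next
      case False
      then have "p \<notin> ?JV"
        using pushout_square_unglued(1)[OF D(4) c(1)] c(2) by simp
      moreover have "p \<in> comps1 P"
        using pushout_square_cover[OF D(4)] c by blast
      ultimately show ?thesis
        using pushout_square_cover[OF D'(4)] JR by blast
    qed
  qed
  have labV: "lsrc1 V ` points (src1 V) \<subseteq> comps1 V" and labU: "ltgt1 U ` points (src1 R) \<subseteq> comps1 U"
    using cospan_labels(1)[OF cospans(2)] cospan_labels(2)[OF cospans(3)] st(3) by auto
  have KWU: "composite K W (relabel i' U) i (\<lambda>x. x)"
  proof -
    have "pushout_square (comps1 K) (?IU \<inter> ?JV) (points (src1 V)) (ltgt1 K) (j \<circ> lsrc1 V) ?IU i (\<lambda>x. x)"
      using pushout_square_cover[OF D'(4)] by (intro pushout_square_restrict[OF D(4) _ IK labV]) blast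
    then show ?thesis
      using st common unfolding composite_def by (simp add: W_def relabel_def)
  qed
  have WRV: "composite W R (relabel j V) (\<lambda>x. x) j'"
  proof -
    have "pushout_square (comps1 R) (?JV \<inter> ?IU) (points (src1 R)) (lsrc1 R) (i' \<circ> ltgt1 U) ?JV j' (\<lambda>x. x)"
      using pushout_square_cover[OF D(4)]
      by (intro pushout_square_restrict[OF pushout_square_sym[OF D'(4)] _ JR labU]) blast
    then have "pushout_square (?IU \<inter> ?JV) (comps1 R) (points (src1 R)) (i' \<circ> ltgt1 U) (lsrc1 R) ?JV (\<lambda>x. x) j'"
      by (subst Int_commute) (rule pushout_square_sym)
    moreover have "j (ltgt1 V b) = j' (ltgt1 R b)" if "b \<in> points (tgt1 V)" for b
      using D'(6)[of b] D(6)[of b] that st(4) by simp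
    ultimately show ?thesis
      using st unfolding composite_def by (simp add: W_def relabel_def)
  qed
  have labW: "lsrc1 W ` points (src1 W) \<subseteq> comps1 W" "ltgt1 W ` points (tgt1 W) \<subseteq> comps1 W"
  proof -
    have "j (lsrc1 V y) \<in> ?IU \<inter> ?JV" if "y \<in> points (src1 V)" for y
    proof -
      have "j (lsrc1 V y) = i (ltgt1 K y)" "ltgt1 K y \<in> comps1 K"
        using pushout_square_commutes[OF D(4) that] cospan_labels(2)[OF cospans(1)] that st(2) by simp_all
      moreover from this have "i (ltgt1 K y) \<in> ?IU"
        using IK by blast
      moreover have "j (lsrc1 V y) \<in> ?JV"
        using labV that by blast
      ultimately show ?thesis
        by simp
    qed
    moreover have "i' (ltgt1 U z) \<in> ?IU \<inter> ?JV" if "z \<in> points (src1 R)" for z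
    proof -
      have "i' (ltgt1 U z) = j' (lsrc1 R z)" "lsrc1 R z \<in> comps1 R"
        using pushout_square_commutes[OF D'(4) that] cospan_labels(1)[OF cospans(4)] that by simp_all
      moreover from this have "j' (lsrc1 R z) \<in> ?JV"
        using JR by blast
      moreover have "i' (ltgt1 U z) \<in> ?IU"
        using labU that by blast
      ultimately show ?thesis
        by simp
    qed
    ultimately show "lsrc1 W ` points (src1 W) \<subseteq> comps1 W" "ltgt1 W ` points (tgt1 W) \<subseteq> comps1 W"
      using st(3) by (auto simp: W_def)
  qed
  have W: "is_cob1 W"
  proof (rule balanced_is_cob1)
    show "cospan W"
      using labW cospans(2,3) unfolding cospan_def by (simp add: W_def)
    let ?p = "lsrc1 U ` pos (src1 U)" and ?n = "lsrc1 U ` neg (src1 U)"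
    let ?p' = "ltgt1 U ` pos (tgt1 U)" and ?n' = "ltgt1 U ` neg (tgt1 U)"
    have U: "inj_on (ltgt1 U) (pos (tgt1 U))" "inj_on (ltgt1 U) (neg (tgt1 U))"
        "?p \<inter> ?n' = {}" "?n \<inter> ?p' = {}" "?p \<union> ?n' = ?n \<union> ?p'"
      using is_cob1_balanced[OF cobs(3)] unfolding balanced_iff by blast+
    have V: "inj_on (lsrc1 V) (pos (src1 V))" "inj_on (lsrc1 V) (neg (src1 V))"
      using is_cob1_balanced[OF cobs(2)] unfolding balanced_iff by blast+
    have K': "lsrc1 K ` pos (src1 K) \<inter> ltgt1 K ` neg (tgt1 K) = {}"
        "lsrc1 K ` neg (src1 K) \<inter> ltgt1 K ` pos (tgt1 K) = {}"
      using is_cob1_balanced[OF cobs(1)] unfolding balanced_iff by blast+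
    have through: "(j ` lsrc1 V ` pos (src1 V) = i' ` ?p \<inter> ?JV) \<and> (j ` lsrc1 V ` neg (src1 V) = i' ` ?n \<inter> ?JV)"
    proof -
      have down: "\<exists>x\<in>points (src1 K). ltgt1 K y = lsrc1 K x \<and> j (lsrc1 V y) = i' (lsrc1 U x)"
        if "y \<in> points (src1 V)" for y
      proof -
        have "ltgt1 K y \<in> lsrc1 K ` points (src1 K)"
          using K that st(2) by (auto simp: cofib_def)
        then obtain x where "x \<in> points (src1 K)" "ltgt1 K y = lsrc1 K x"
          by blast
        then show ?thesis
          using pushout_square_commutes[OF D(4) that] common by auto
      qed
      have up: "\<exists>y\<in>points (src1 V). ltgt1 K y = lsrc1 K x \<and> j (lsrc1 V y) = i' (lsrc1 U x)"
        if "x \<in> points (src1 K)" "i' (lsrc1 U x) \<in> ?JV" for x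
      proof -
        have "lsrc1 K x \<in> ltgt1 K ` points (src1 V)"
          using pushout_square_unglued(1)[OF D(4), of "lsrc1 K x"] cospan_labels(1)[OF cospans(1)]
            common[OF that(1)] that by auto
        then obtain y where "y \<in> points (src1 V)" "ltgt1 K y = lsrc1 K x"
          by auto
        then show ?thesis
          using pushout_square_commutes[OF D(4), of y] common[OF that(1)] by auto
      qed
      show ?thesis
      proof (intro conjI equalityI subsetI)
        fix c assume "c \<in> j ` lsrc1 V ` pos (src1 V)"
        then obtain y where y: "y \<in> pos (src1 V)" "c = j (lsrc1 V y)"
          by blast
        then obtain x where "x \<in> points (src1 K)" "ltgt1 K y = lsrc1 K x" "c = i' (lsrc1 U x)"
          using down[of y] by (auto simp: points_def)
        moreover from this have "x \<in> pos (src1 U)"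
          using K'(2) y(1) st(1,2) by (auto simp: points_def)
        moreover have "c \<in> ?JV"
          using y labV by (auto simp: points_def)
        ultimately show "c \<in> i' ` ?p \<inter> ?JV"
          by blast
      next
        fix c assume "c \<in> j ` lsrc1 V ` neg (src1 V)"
        then obtain y where y: "y \<in> neg (src1 V)" "c = j (lsrc1 V y)"
          by blast
        then obtain x where "x \<in> points (src1 K)" "ltgt1 K y = lsrc1 K x" "c = i' (lsrc1 U x)"
          using down[of y] by (auto simp: points_def)
        moreover from this have "x \<in> neg (src1 U)"
          using K'(1) y(1) st(1,2) by (auto simp: points_def)
        moreover have "c \<in> ?JV"
          using y labV by (auto simp: points_def)
        ultimately show "c \<in> i' ` ?n \<inter> ?JV"
          by blast
      next
        fix c assume "c \<in> i' ` ?p \<inter> ?JV"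
        then obtain x where x: "x \<in> pos (src1 K)" "c = i' (lsrc1 U x)" "c \<in> ?JV"
          using st(1) by auto
        then obtain y where "y \<in> points (src1 V)" "ltgt1 K y = lsrc1 K x" "j (lsrc1 V y) = c"
          using up[of x] by (auto simp: points_def)
        moreover from this have "y \<in> pos (src1 V)"
          using K'(1) x(1) st(2) by (auto simp: points_def)
        ultimately show "c \<in> j ` lsrc1 V ` pos (src1 V)"
          by blast
      next
        fix c assume "c \<in> i' ` ?n \<inter> ?JV"
        then obtain x where x: "x \<in> neg (src1 K)" "c = i' (lsrc1 U x)" "c \<in> ?JV"
          using st(1) by auto
        then obtain y where "y \<in> points (src1 V)" "ltgt1 K y = lsrc1 K x" "j (lsrc1 V y) = c"
          using up[of x] by (auto simp: points_def)
        moreover from this have "y \<in> neg (src1 V)"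
          using K'(2) x(1) st(2) by (auto simp: points_def)
        ultimately show "c \<in> j ` lsrc1 V ` neg (src1 V)"
          by blast
      qed
    qed
    have sub: "pos (src1 V) \<subseteq> points (src1 V)" "neg (src1 V) \<subseteq> points (src1 V)"
        "pos (tgt1 U) \<subseteq> points (tgt1 U)" "neg (tgt1 U) \<subseteq> points (tgt1 U)"
      by (auto simp: points_def)
    have Vc: "lsrc1 V ` pos (src1 V) \<subseteq> comps1 V" "lsrc1 V ` neg (src1 V) \<subseteq> comps1 V"
      using labV sub by blast+
    have Uc: "?p \<subseteq> comps1 U" "?n \<subseteq> comps1 U" "?p' \<subseteq> comps1 U" "?n' \<subseteq> comps1 U"
      using cospan_labels(1,2)[OF cospans(3)] by (auto simp: points_def)
    have inj_jV: "inj_on (j \<circ> lsrc1 V) (pos (src1 V))" "inj_on (j \<circ> lsrc1 V) (neg (src1 V))"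
      using V inj(1) Vc by (auto intro!: comp_inj_on intro: inj_on_subset)
    have inj_iU: "inj_on (i' \<circ> ltgt1 U) (pos (tgt1 U))" "inj_on (i' \<circ> ltgt1 U) (neg (tgt1 U))"
      using U(1,2) inj(2) Uc by (auto intro!: comp_inj_on intro: inj_on_subset)
    have apart: "i' ` ?p \<inter> i' ` ?n' = {}" "i' ` ?n \<inter> i' ` ?p' = {}"
      using inj_on_image_Int[OF inj(2) Uc(1,4)] inj_on_image_Int[OF inj(2) Uc(2,3)] U(3,4) by simp_all
    have total: "i' ` ?p \<union> i' ` ?n' = i' ` ?n \<union> i' ` ?p'"
      using U(5) by (metis image_Un)
    have inV: "i' ` ?p' \<subseteq> ?JV" "i' ` ?n' \<subseteq> ?JV"
      using labW(2) sub(3,4) by (auto simp: W_def image_subset_iff subset_iff)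
    have ends: "lsrc1 W ` pos (src1 W) = i' ` ?p \<inter> ?JV" "lsrc1 W ` neg (src1 W) = i' ` ?n \<inter> ?JV"
        "ltgt1 W ` pos (tgt1 W) = i' ` ?p'" "ltgt1 W ` neg (tgt1 W) = i' ` ?n'"
      using through by (simp_all add: W_def image_image)
    show "balanced W"
      unfolding balanced_iff ends
    proof (intro conjI)
      show "i' ` ?p \<inter> ?JV \<inter> i' ` ?n' = {}" "i' ` ?n \<inter> ?JV \<inter> i' ` ?p' = {}"
        using apart by blast+
      show "i' ` ?p \<inter> ?JV \<union> i' ` ?n' = i' ` ?n \<inter> ?JV \<union> i' ` ?p'"
        by (simp add: Un_Int_distrib2 total Un_absorb2 inV)
    qed (use inj_jV inj_iU in \<open>simp_all add: W_def\<close>)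
  qed
  have "\<exists>k l. composite K W U k l"
    by (rule composite_relabelled[OF KWU equiv1_sym[OF cobs(3) equiv1_relabel[OF inj(2)]]])
  moreover have "\<exists>k l. composite W R V k l"
    by (rule composite_relabelled[OF WRV equiv1_sym[OF cobs(2) equiv1_relabel[OF inj(1)]]])
  ultimately show ?thesis
    using W by blast
qed


theorem theorem5p4p7:
  shows "orthogonal_factorization_system
           (one_Cob :: ('a signed_set, ('a, nat) cob1 set) cat) cofibrations1 fibrations1"
proof -
  let ?C = "one_Cob :: ('a signed_set, ('a, nat) cob1 set) cat"
  interpret category ?C
    by (rule category_one_Cob)
  have iso: "f \<in> cofibrations1 \<inter> fibrations1" if iso: "f \<in> isomorphisms ?C" for f
  proof -
    obtain X Y g where f: "f \<in> Hom ?C X Y" and g: "g \<in> Hom ?C Y X"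
      and gf: "cmp ?C g f = Id ?C X" and fg: "cmp ?C f g = Id ?C Y"
      using iso unfolding isomorphisms_def by auto
    obtain K :: "('a, nat) cob1" where K: "f = class1 K" "is_cob1 K" "src1 K = X" "tgt1 K = Y"
      using f by (rule Hom_one_CobE)
    obtain L :: "('a, nat) cob1" where L: "g = class1 L" "is_cob1 L" "src1 L = Y" "tgt1 L = X"
      using g by (rule Hom_one_CobE)
    have ids: "is_cob1 (id_cob1 X)" "is_cob1 (id_cob1 Y)"
      using Hom_Ob[OF f] by (simp_all add: id_cob1_is_cob1)
    obtain i j where KL: "composite K L (id_cob1 X) i j"
      using gf cmp_class1_iff[OF K(2) L(2) ids(1)] K(1,4) L(1,3) by auto
    obtain i' j' where LK: "composite L K (id_cob1 Y) i' j'"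
      using fg cmp_class1_iff[OF L(2) K(2) ids(2)] K(1,3) L(1,4) by auto
    show ?thesis
      using invertible_cofib_fib[OF KL LK] K(2) L(2) cofibrations1_iff[OF K(2)] fibrations1_iff[OF K(2)]
      by (simp add: K(1) is_cob1_cospan)
  qed
  show ?thesis
  proof
    show "cofibrations1 \<subseteq> Arr ?C" "fibrations1 \<subseteq> Arr ?C"
      unfolding cofibrations1_def fibrations1_def by blast+
    show "isomorphisms ?C \<subseteq> cofibrations1" "isomorphisms ?C \<subseteq> fibrations1"
      using iso by blast+
    have closed: "(f \<in> cofibrations1 \<and> g \<in> cofibrations1 \<longrightarrow> cmp ?C g f \<in> cofibrations1) \<and>
        (f \<in> fibrations1 \<and> g \<in> fibrations1 \<longrightarrow> cmp ?C g f \<in> fibrations1)"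
      if f: "f \<in> Hom ?C X Y" and g: "g \<in> Hom ?C Y Z" for f g X Y Z
    proof -
      obtain K :: "('a, nat) cob1" where K: "f = class1 K" "is_cob1 K" "src1 K = X" "tgt1 K = Y"
        using f by (rule Hom_one_CobE)
      obtain L :: "('a, nat) cob1" where L: "g = class1 L" "is_cob1 L" "src1 L = Y" "tgt1 L = Z"
        using g by (rule Hom_one_CobE)
      obtain P :: "('a, nat) cob1" where P: "cmp ?C g f = class1 P" "is_cob1 P" "src1 P = X" "tgt1 P = Z"
        using cmp_Hom[OF f g] by (rule Hom_one_CobE)
      obtain i j where comp: "composite K L P i j"
        using cmp_class1_iff[OF K(2) L(2) P(2)] P(1) K(1,4) L(1,3) by auto
      show ?thesis
        unfolding P(1) unfolding K(1) L(1) cofibrations1_iff[OF K(2)] cofibrations1_iff[OF L(2)]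
          cofibrations1_iff[OF P(2)] fibrations1_iff[OF K(2)] fibrations1_iff[OF L(2)] fibrations1_iff[OF P(2)]
        using cofib_composite[OF comp] fib_composite[OF comp] K(2) L(2) is_cob1_cospan by blast
    qed
    show "closed_under_cmp ?C cofibrations1" "closed_under_cmp ?C fibrations1"
      unfolding closed_under_cmp_def using closed by blast+
    show "\<exists>Z\<in>Ob ?C. \<exists>e\<in>cofibrations1 \<inter> Hom ?C X Z. \<exists>r\<in>fibrations1 \<inter> Hom ?C Z Y. f = cmp ?C r e"
      if f: "f \<in> Hom ?C X Y" for f X Y
    proof -
      obtain K :: "('a, nat) cob1" where K: "f = class1 K" "is_cob1 K" "src1 K = X" "tgt1 K = Y"
        using f by (rule Hom_one_CobE)
      obtain E R :: "('a, nat) cob1" and i j where ER: "is_cob1 E" "is_cob1 R" "cofib E" "fib R"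
          and comp: "composite E R K i j"
        using factorization_cob1[OF K(2)] by blast
      have "class1 E \<in> cofibrations1 \<inter> Hom ?C X (src1 R)" "class1 R \<in> fibrations1 \<inter> Hom ?C (src1 R) Y"
        using ER compositeD(1-3)[OF comp] K(3,4)
        by (simp_all add: cofibrations1_iff fibrations1_iff class1_Hom)
      moreover have "f = cmp ?C (class1 R) (class1 E)"
        using cmp_class1[OF comp ER(1,2)] K(1) by simp
      ultimately show ?thesis
        using Hom_Ob by blast
    qed
    show "\<exists>!w. w \<in> Hom ?C Y X' \<and> cmp ?C w e = u \<and> cmp ?C r w = v"
      if "e \<in> cofibrations1" and e: "e \<in> Hom ?C X Y" and "r \<in> fibrations1" and r: "r \<in> Hom ?C X' Y'"
        and u: "u \<in> Hom ?C X X'" and v: "v \<in> Hom ?C Y Y'" and square: "cmp ?C v e = cmp ?C r u"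
      for e r u v X Y X' Y'
    proof -
      obtain K :: "('a, nat) cob1" where K: "e = class1 K" "is_cob1 K" "src1 K = X" "tgt1 K = Y"
        using e by (rule Hom_one_CobE)
      obtain R :: "('a, nat) cob1" where R: "r = class1 R" "is_cob1 R" "src1 R = X'" "tgt1 R = Y'"
        using r by (rule Hom_one_CobE)
      obtain U :: "('a, nat) cob1" where U: "u = class1 U" "is_cob1 U" "src1 U = X" "tgt1 U = X'"
        using u by (rule Hom_one_CobE)
      obtain V :: "('a, nat) cob1" where V: "v = class1 V" "is_cob1 V" "src1 V = Y" "tgt1 V = Y'"
        using v by (rule Hom_one_CobE)
      have cof: "cofib K" and fib: "fib R"
        using that(1,3) K(1,2) R(1,2) by (simp_all add: cofibrations1_iff fibrations1_iff)
      obtain P :: "('a, nat) cob1" where P: "cmp ?C v e = class1 P" "is_cob1 P" "src1 P = X" "tgt1 P = Y'"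
        using cmp_Hom[OF e v] by (rule Hom_one_CobE)
      obtain i j where KV: "composite K V P i j"
        using cmp_class1_iff[OF K(2) V(2) P(2)] P(1) K(1,4) V(1,3) by auto
      obtain i' j' where UR: "composite U R P i' j'"
        using cmp_class1_iff[OF U(2) R(2) P(2)] P(1) square U(1,4) R(1,3) by auto
      obtain W :: "('a, nat) cob1" and k l k' l' where W: "is_cob1 W"
          and KW: "composite K W U k l" and WR: "composite W R V k' l'"
        using lifting_cob1[OF KV UR cof fib K(2) V(2) U(2) R(2)] by blast
      show ?thesis
      proof (rule ex1I[of _ "class1 W"])
        have "src1 W = Y" "tgt1 W = X'"
          using compositeD(1)[OF KW] compositeD(1)[OF WR] K(4) R(3) by simp_all
        then show "class1 W \<in> Hom ?C Y X' \<and> cmp ?C (class1 W) e = u \<and> cmp ?C r (class1 W) = v"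
          using class1_Hom[OF W] cmp_class1[OF KW K(2) W] cmp_class1[OF WR W R(2)]
          by (simp add: K(1) R(1) U(1) V(1))
      next
        fix w assume w: "w \<in> Hom ?C Y X' \<and> cmp ?C w e = u \<and> cmp ?C r w = v"
        then have "w \<in> Hom ?C Y X'"
          by blast
        then obtain W' :: "('a, nat) cob1" where W': "w = class1 W'" "is_cob1 W'" "src1 W' = Y" "tgt1 W' = X'"
          by (rule Hom_one_CobE)
        obtain i j where KW': "composite K W' U i j"
          using cmp_class1_iff[OF K(2) W'(2) U(2)] w K(1,4) U(1) W'(1,3) by auto
        have "equiv1 W' W"
          using cofib_cancel[OF KW' KW cof] K(2) W'(2) W U(2) by (simp add: is_cob1_cospan)
        then show "w = class1 W"
          using class1_eq_iff[OF W'(2) W] W'(1) by simp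
      qed
    qed
  qed
qed

end
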